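(* Let $\epsilon>0$ be the desired accuracy, assume the truncation parameter $X>0$ satisfies $X^{-1}=\mathcal{O}(\epsilon)$, let $p^{\Diamond}\ge\lambda_{\max}^+(H_1)T$, and let $\tilde\Omega_p=(p^{\Diamond},p^{\Diamond}+R)$, where $R\ge1$ is the length of the recovery domain with $e^R=\mathcal{O}(1)$. Then there is a constant $C>0$ independent of the numerical mesh size (and time step) such that, at time $T$, $$\|\boldsymbol{u}_h^c-\boldsymbol{u}\|_{L^2(\tilde\Omega_p)}\le C\left(\epsilon+\epsilon^{-1}\triangle\xi^2\Big((p^{\Diamond})^2+\Big\|\int_0^TH_1(s)\,ds\Big\|^2\Big)\right)e^{p^{\Diamond}}\|\boldsymbol{u}_0\|,$$ where $\boldsymbol{u}=\boldsymbol{u}(T)$ is regarded as a constant function of $p$ and $\boldsymbol{u}_h^c=\boldsymbol{u}_h^c(T,p)$.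
   Context: Fix $T>0$, $n\ge1$, $A:[0,T]\to\mathbb{C}^{n\times n}$ continuous and $\boldsymbol{u}_0\in\mathbb{C}^n$; $\boldsymbol{u}$ solves $\frac{\mathrm{d}}{\mathrm{d}t}\boldsymbol{u}=A(t)\boldsymbol{u}$, $\boldsymbol{u}(0)=\boldsymbol{u}_0$. Write $H_1=(A+A^\dagger)/2$, $H_2=(A-A^\dagger)/(2i)$ and, with $\sigma(\cdot)$ the set of eigenvalues, $\lambda_{\max}^+(H_1)=\max\{\sup_{0<t<T}\{|\lambda|:\lambda\in\sigma(H_1(t)),\lambda>0\},0\}$. $\|\cdot\|$ is the Euclidean norm for vectors and the spectral norm for matrices. Discretization. For $X>0$ and a positive integer $N$, let $\triangle\xi=2X/N$, $\xi_j=-X+2jX/N$ ($j=0,\dots,N$), $D_\xi=\mathrm{diag}\{\xi_0,\dots,\xi_N\}$ and $\boldsymbol{\xi}_h=\sum_{j=0}^N\frac{1}{\pi(1+\xi_j^2)}|j\rangle$, with $|j\rangle$ the $j$-th standard basis vector of $\mathbb{C}^{N+1}$. Let $\check{\boldsymbol{w}}_h$ solve (exactly in time) $\frac{\mathrm{d}}{\mathrm{d}t}\check{\boldsymbol{w}}_h=i(D_\xi\otimes H_1+I_{N+1}\otimes H_2)\check{\boldsymbol{w}}_h$, $\check{\boldsymbol{w}}_h(0)=\boldsymbol{\xi}_h\otimes\boldsymbol{u}_0$. With $\check{\boldsymbol{w}}_j=(\langle j|\otimes I_n)\check{\boldsymbol{w}}_h$ set $$\boldsymbol{w}_h^c(t,p)=\triangle\xi\sum_{j=1}^{N-1}\check{\boldsymbol{w}}_je^{-i\xi_jp}+\frac{\triangle\xi}{2}\big(\check{\boldsymbol{w}}_Ne^{-i\xi_Np}+\check{\boldsymbol{w}}_0e^{-i\xi_0p}\big),\qquad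 \boldsymbol{u}_h^c(t,p)=e^p\boldsymbol{w}_h^c(t,p),\quad p\in(p^{\Diamond},p^{\Diamond}+R).$$
   Formalization: A C independent also of ε and X fails if p^◇=0 and H_1=0 (aliasing error); the uniform bound is proved when (p^◇)²+‖∫H_1‖² ≥ δ>0, with C depending on δ, A, T; without that condition C may depend on ε, X, p^◇, R, but not on the mesh. *)

theory Defs
  imports "HOL-Analysis.Analysis"
begin

definition adj_mat :: "complex^'n^'n \<Rightarrow> complex^'n^'n" where
  "adj_mat M = (\<chi> a b. cnj (M $ b $ a))"

definition H1 :: "(real \<Rightarrow> complex^'n^'n) \<Rightarrow> real \<Rightarrow> complex^'n^'n" where
  "H1 A t = (\<chi> a b. (A t $ a $ b + adj_mat (A t) $ a $ b) / 2)"

definition H2 :: "(real \<Rightarrow> complex^'n^'n) \<Rightarrow> real \<Rightarrow> complex^'n^'n" where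
  "H2 A t = (\<chi> a b. (A t $ a $ b - adj_mat (A t) $ a $ b) / (2 * \<i>))"

definition eigenvalues :: "complex^'n^'n \<Rightarrow> complex set" where
  "eigenvalues M = {l. \<exists>v. v \<noteq> 0 \<and> M *v v = l *s v}"

(* Inserting 0 before taking the supremum gives max {sup S, 0} for a set S of
   nonnegative reals, also when S is empty (where Sup on the reals is unspecified). *)
definition lam_max_plus :: "(real \<Rightarrow> complex^'n^'n) \<Rightarrow> real \<Rightarrow> real" where
  "lam_max_plus H T =
     Sup (insert 0 {norm l | t l. 0 < t \<and> t < T \<and> l \<in> eigenvalues (H t) \<and> l \<in> \<real> \<and> 0 < Re l})"

(* The norm of the type complex^'n^'n is the Frobenius norm; the spectral norm is the
   operator norm induced by the Euclidean norm of complex^'n. *)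
definition spectral_norm :: "complex^'n^'n \<Rightarrow> real" where
  "spectral_norm M = onorm (\<lambda>v. M *v v)"

definition solves_linear_ode ::
  "(real \<Rightarrow> complex^'n^'n) \<Rightarrow> real \<Rightarrow> complex^'n \<Rightarrow> (real \<Rightarrow> complex^'n) \<Rightarrow> bool" where
  "solves_linear_ode A T u0 u \<longleftrightarrow>
     u 0 = u0 \<and> (\<forall>t\<in>{0..T}. (u has_vector_derivative A t *v u t) (at t within {0..T}))"

definition mesh :: "real \<Rightarrow> nat \<Rightarrow> real" where
  "mesh X N = 2 * X / real N"

definition xi :: "real \<Rightarrow> nat \<Rightarrow> nat \<Rightarrow> real" where
  "xi X N j = - X + 2 * real j * X / real N"

(* Since N is quantified, a vector of C^(N+1) is a function on nat of which only the
   entries 0, ..., N matter, and a vector of the tensor product of C^(N+1) with C^n is a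
   function on pairs (j, a) with j <= N; matrices are treated likewise. *)

definition D_xi :: "real \<Rightarrow> nat \<Rightarrow> nat \<Rightarrow> nat \<Rightarrow> complex" where
  "D_xi X N j k = (if j = k then of_real (xi X N j) else 0)"

definition id_mat :: "nat \<Rightarrow> nat \<Rightarrow> complex" where
  "id_mat j k = (if j = k then 1 else 0)"

definition xi_vec :: "real \<Rightarrow> nat \<Rightarrow> nat \<Rightarrow> complex" where
  "xi_vec X N j = of_real (1 / (pi * (1 + (xi X N j)\<^sup>2)))"

definition kron ::
  "(nat \<Rightarrow> nat \<Rightarrow> complex) \<Rightarrow> complex^'n^'n \<Rightarrow> nat \<times> 'n \<Rightarrow> nat \<times> 'n \<Rightarrow> complex" where
  "kron P Q = (\<lambda>(j, a) (k, b). P j k * Q $ a $ b)"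

definition kron_vec :: "(nat \<Rightarrow> complex) \<Rightarrow> complex^'n \<Rightarrow> nat \<times> 'n \<Rightarrow> complex" where
  "kron_vec x v = (\<lambda>(j, a). x j * v $ a)"

definition semidiscrete_mat ::
  "(real \<Rightarrow> complex^'n^'n) \<Rightarrow> real \<Rightarrow> nat \<Rightarrow> real \<Rightarrow> nat \<times> 'n \<Rightarrow> nat \<times> 'n \<Rightarrow> complex" where
  "semidiscrete_mat A X N t r s =
     \<i> * (kron (D_xi X N) (H1 A t) r s + kron id_mat (H2 A t) r s)"

definition solves_semidiscrete ::
  "(real \<Rightarrow> complex^'n^'n) \<Rightarrow> real \<Rightarrow> real \<Rightarrow> nat \<Rightarrow> complex^'n
    \<Rightarrow> (real \<Rightarrow> nat \<times> 'n \<Rightarrow> complex) \<Rightarrow> bool" where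
  "solves_semidiscrete A T X N u0 w \<longleftrightarrow>
     (\<forall>r\<in>{0..N} \<times> UNIV.
        w 0 r = kron_vec (xi_vec X N) u0 r \<and>
        (\<forall>t\<in>{0..T}.
           ((\<lambda>t. w t r) has_vector_derivative
              (\<Sum>s\<in>{0..N} \<times> UNIV. semidiscrete_mat A X N t r s * w t s)) (at t within {0..T})))"

definition block :: "(nat \<times> 'n \<Rightarrow> complex) \<Rightarrow> nat \<Rightarrow> complex^'n" where
  "block w j = (\<chi> a. w (j, a))"

definition w_hc :: "real \<Rightarrow> nat \<Rightarrow> (real \<Rightarrow> nat \<times> 'n \<Rightarrow> complex) \<Rightarrow> real \<Rightarrow> real \<Rightarrow> complex^'n" where
  "w_hc X N w t p =
     mesh X N *\<^sub>R (\<Sum>j = 1..N - 1. exp (- \<i> * of_real (xi X N j * p)) *s block (w t) j)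
     + (mesh X N / 2) *\<^sub>R
         (exp (- \<i> * of_real (xi X N N * p)) *s block (w t) N
          + exp (- \<i> * of_real (xi X N 0 * p)) *s block (w t) 0)"

definition u_hc :: "real \<Rightarrow> nat \<Rightarrow> (real \<Rightarrow> nat \<times> 'n \<Rightarrow> complex) \<Rightarrow> real \<Rightarrow> real \<Rightarrow> complex^'n" where
  "u_hc X N w t p = exp p *\<^sub>R w_hc X N w t p"

definition L2_norm_on :: "real set \<Rightarrow> (real \<Rightarrow> complex^'n) \<Rightarrow> real" where
  "L2_norm_on S f = sqrt (LINT p:S|lborel. (norm (f p))\<^sup>2)"

end

theory Submission
  imports Defs "HOL-Complex_Analysis.Complex_Analysis"
begin

text \<open>
  For complex \<open>z\<close> let \<open>V z\<close> solve \<open>v' = i (z H\<^sub>1 + H\<^sub>2) v\<close>, \<open>v 0 = u\<^sub>0\<close>. The Dyson series shows that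
  \<open>V z T\<close> is entire in \<open>z\<close>; moreover \<open>V (-i) = u\<close>, and the blocks of the semidiscrete solution are
  \<open>V \<xi>\<^sub>j / (\<pi> (1 + \<xi>\<^sub>j\<^sup>2))\<close>. So \<open>w\<^sub>h\<^sup>c\<close> is the trapezoidal sum of
  \<open>V z T e\<^sup>-\<^sup>i\<^sup>z\<^sup>p / (\<pi> (1 + z\<^sup>2))\<close>. Energy estimates bound \<open>V z T e\<^sup>-\<^sup>i\<^sup>z\<^sup>p\<close> on the lower half
  plane when \<open>p \<ge> \<lambda>\<^sub>m\<^sub>a\<^sub>x T\<close>, so shifting \<open>[-X, X]\<close> to the lower semicircle picks up the pole at \<open>-i\<close>,
  whose contribution is \<open>e\<^sup>-\<^sup>p u T\<close>, with an error \<open>O(1/X)\<close>. Cauchy's estimate on circles of radius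
  \<open>1 / (2 (1 + p))\<close> bounds the derivative of the integrand and gives a quadrature error
  \<open>O(\<triangle>\<xi> (1 + p))\<close>. First order suffices, since \<open>\<epsilon> + \<epsilon>\<^sup>-\<^sup>1 \<triangle>\<xi>\<^sup>2 D \<ge> 2 \<triangle>\<xi> \<surd>D\<close>.
\<close>

unbundle no Formal_Power_Series.fps_syntax

section \<open>Trapezoidal rule\<close>

lemma xi_diff: "N > 0 \<Longrightarrow> xi X N (Suc j) - xi X N j = mesh X N"
  by (simp add: xi_def mesh_def field_simps)

lemma xi_0: "xi X N 0 = - X"
  by (simp add: xi_def)

lemma xi_N: "N > 0 \<Longrightarrow> xi X N N = X"
  by (simp add: xi_def)

lemma arctan_has_vector_derivative:
  "((\<lambda>x. c * arctan x) has_vector_derivative c / (1 + x\<^sup>2)) (at x within S)"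
  unfolding has_real_derivative_iff_has_vector_derivative[symmetric]
  by (auto intro!: derivative_eq_intros simp: field_simps)

text \<open>Mean value inequality with the majorant \<open>c * arctan x\<close>. Every integrand
  below decays like \<open>1 / (1 + x^2)\<close>, and measuring it by arctangents gives total errors
  that stay bounded as the interval grows.\<close>

lemma has_vector_derivative_arctan_bound:
  fixes F :: "real \<Rightarrow> 'a::real_normed_vector"
  assumes "a \<le> b"
    and "\<And>x. (F has_vector_derivative f x) (at x)"
    and "\<And>x. a < x \<Longrightarrow> x < b \<Longrightarrow> norm (f x) \<le> c / (1 + x\<^sup>2)"
  shows "norm (F b - F a) \<le> c * (arctan b - arctan a)"
proof (cases "a = b")
  case False
  have "norm (F b - F a) \<le> c * arctan b - c * arctan a"
  proof (rule differentiable_bound_general)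
    show "continuous_on {a..b} F"
      using assms(2) by (meson continuous_at_imp_continuous_on has_vector_derivative_continuous)
    show "((\<lambda>x. c * arctan x) has_vector_derivative c / (1 + x\<^sup>2)) (at x)" for x
      by (rule arctan_has_vector_derivative)
  qed (use assms False in \<open>auto intro!: continuous_intros\<close>)
  then show ?thesis by (simp add: right_diff_distrib)
qed simp

text \<open>Only the first derivative enters, so one factor of the cell width is gained. The other
  factor is kept as an arctangent increment, which telescopes when the cells are added up.\<close>

lemma trapezoid_cell_bound:
  fixes F :: "real \<Rightarrow> 'a::real_normed_vector"
  assumes ab: "a \<le> b"
    and F: "\<And>x. (F has_vector_derivative f x) (at x)"
    and f: "\<And>x. (f has_vector_derivative f' x) (at x)"
    and f': "\<And>x. norm (f' x) \<le> M / (1 + x\<^sup>2)"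
  shows "norm (F b - F a - ((b - a) / 2) *\<^sub>R (f a + f b)) \<le> (b - a) / 2 * M * (arctan b - arctan a)"
proof -
  define m where "m = (a + b) / 2"
  \<comment> \<open>integration by parts: \<open>E' x = - (x - m) f' x\<close>\<close>
  define E where "E = (\<lambda>x. F x - (x - m) *\<^sub>R f x)"
  have "(E has_vector_derivative - ((x - m) *\<^sub>R f' x)) (at x)" for x
    unfolding E_def by (auto intro!: derivative_eq_intros F f)
  moreover have "norm (- ((x - m) *\<^sub>R f' x)) \<le> (b - a) / 2 * M / (1 + x\<^sup>2)" if "a < x" "x < b" for x
  proof -
    have "\<bar>x - m\<bar> \<le> (b - a) / 2" using that by (auto simp: m_def field_simps)
    then have "\<bar>x - m\<bar> * norm (f' x) \<le> (b - a) / 2 * (M / (1 + x\<^sup>2))"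
      using f' ab by (intro mult_mono) auto
    then show ?thesis by simp
  qed
  ultimately have "norm (E b - E a) \<le> (b - a) / 2 * M * (arctan b - arctan a)"
    by (intro has_vector_derivative_arctan_bound ab)
  moreover have bm: "b - m = (b - a) / 2" "a - m = - ((b - a) / 2)" by (auto simp: m_def field_simps)
  have "E b - E a = F b - F a - ((b - a) / 2) *\<^sub>R (f a + f b)"
    unfolding E_def bm by (simp add: scaleR_right_distrib)
  ultimately show ?thesis by simp
qed

text \<open>The grouping and the order of the end terms copy \<open>w_hc\<close>, so each component
  of \<open>w_hc\<close> is such a sum node by node.\<close>

definition trapezoid_sum :: "real \<Rightarrow> nat \<Rightarrow> (real \<Rightarrow> 'a::real_vector) \<Rightarrow> 'a" where
  "trapezoid_sum X N f =
     mesh X N *\<^sub>R (\<Sum>j = 1..N - 1. f (xi X N j)) + (mesh X N / 2) *\<^sub>R (f (xi X N N) + f (xi X N 0))"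

lemma trapezoid_sum_cells:
  assumes "N > 0"
  shows "trapezoid_sum X N f = (\<Sum>j<N. (mesh X N / 2) *\<^sub>R (f (xi X N j) + f (xi X N (Suc j))))"
proof -
  \<comment> \<open>Induction runs over the number of interior nodes \<open>n\<close>, with
    \<open>Suc n\<close> cells; \<open>N > 0\<close> lets \<open>n = N - 1\<close> be inserted
    despite truncated subtraction.\<close>
  have "(d / 2) *\<^sub>R (\<Sum>j<Suc n. g j + g (Suc j)) = d *\<^sub>R (\<Sum>j = 1..n. g j) + (d / 2) *\<^sub>R (g (Suc n) + g 0)"
    for d n and g :: "nat \<Rightarrow> 'a"
  proof (induction n)
    case (Suc n)
    have "d *\<^sub>R g (Suc n) = (d / 2) *\<^sub>R g (Suc n) + (d / 2) *\<^sub>R g (Suc n)"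
      by (simp flip: scaleR_add_left)
    with Suc show ?case by (simp add: scaleR_right_distrib ac_simps)
  qed (simp add: add.commute)
  from this[where d = "mesh X N" and n = "N - 1" and g = "\<lambda>j. f (xi X N j)"] assms show ?thesis
    unfolding trapezoid_sum_def by (simp add: scaleR_sum_right)
qed

text \<open>The cell bounds telescope to \<open>2 * arctan X\<close>, which is less than pi and
  hence at most 4. The constant is therefore independent of the truncation \<open>X\<close>.\<close>

lemma trapezoid_sum_bound:
  fixes F :: "real \<Rightarrow> 'a::real_normed_vector"
  assumes "X > 0" "N > 0"
    and F: "\<And>x. (F has_vector_derivative f x) (at x)"
    and f: "\<And>x. (f has_vector_derivative f' x) (at x)"
    and f': "\<And>x. norm (f' x) \<le> M / (1 + x\<^sup>2)"
  shows "norm (trapezoid_sum X N f - (F X - F (- X))) \<le> 2 * mesh X N * M"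
proof -
  let ?x = "xi X N" and ?d = "mesh X N"
  have d: "?d \<ge> 0" using assms by (simp add: mesh_def)
  have M: "M \<ge> 0" using f'[of 0] norm_ge_zero[of "f' 0"] by (simp del: norm_ge_zero) 
  have cell: "norm (F (?x (Suc j)) - F (?x j) - (?d / 2) *\<^sub>R (f (?x j) + f (?x (Suc j))))
      \<le> ?d / 2 * M * (arctan (?x (Suc j)) - arctan (?x j))" for j
    using trapezoid_cell_bound[OF _ F f f', of "?x j" "?x (Suc j)"] xi_diff[of N X j] d assms by simp
  have "F X - F (- X) - trapezoid_sum X N f =
     (\<Sum>j<N. F (?x (Suc j)) - F (?x j) - (?d / 2) *\<^sub>R (f (?x j) + f (?x (Suc j))))"
    using assms sum_lessThan_telescope[of "\<lambda>j. F (?x j)" N]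
    by (simp add: trapezoid_sum_cells sum_subtractf xi_0 xi_N)
  also have "norm \<dots> \<le> (\<Sum>j<N. ?d / 2 * M * (arctan (?x (Suc j)) - arctan (?x j)))"
    by (rule sum_norm_le) (rule cell)
  also have "\<dots> = ?d / 2 * M * (2 * arctan X)"
    unfolding sum_distrib_left[symmetric]
    using assms sum_lessThan_telescope[of "\<lambda>j. arctan (?x j)" N] by (simp add: xi_0 xi_N arctan_minus)
  also have "\<dots> \<le> ?d / 2 * M * 4"
  proof (rule mult_left_mono)
    show "2 * arctan X \<le> 4" using arctan_ubound[of X] pi_less_4 by linarith
  qed (use d M in auto)
  finally show ?thesis by (simp add: norm_minus_commute mult_ac)
qed

section \<open>Quadrature of the Fourier integral\<close>

lemma norm_one_plus_square:
  fixes z :: complex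
  shows "norm (1 + z\<^sup>2) = norm (z - \<i>) * norm (z + \<i>)"
proof -
  have "1 + z\<^sup>2 = (z - \<i>) * (z + \<i>)" by (simp add: algebra_simps power2_eq_square)
  then show ?thesis by (simp add: norm_mult)
qed

text \<open>The point \<open>x\<close> has distance \<open>sqrt (1 + x^2) \<ge> 1\<close> from both
  poles \<open>i\<close> and \<open>-i\<close>. A displacement of at most 1/2 costs at most half of
  each distance, hence the factor 1/4 for the product.\<close>

lemma norm_one_plus_square_ge:
  fixes z :: complex
  assumes "norm (z - of_real x) \<le> 1 / 2"
  shows "norm (1 + z\<^sup>2) \<ge> (1 + x\<^sup>2) / 4"
proof -
  have sq: "norm (of_real x - \<i>) = sqrt (1 + x\<^sup>2)" "norm (of_real x + \<i>) = sqrt (1 + x\<^sup>2)"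
    by (simp_all add: cmod_def add.commute)
  have "1 \<le> sqrt (1 + x\<^sup>2)" by simp
  moreover have "sqrt (1 + x\<^sup>2) - 1 / 2 \<le> norm (z - \<i>)" "sqrt (1 + x\<^sup>2) - 1 / 2 \<le> norm (z + \<i>)"
    using assms norm_triangle_ineq[of "of_real x - z" "z - \<i>"] norm_triangle_ineq[of "of_real x - z" "z + \<i>"]
    by (auto simp: sq norm_minus_commute[of "of_real x" z])
  ultimately have "sqrt (1 + x\<^sup>2) / 2 \<le> norm (z - \<i>)" "sqrt (1 + x\<^sup>2) / 2 \<le> norm (z + \<i>)"
    by linarith+
  then have "sqrt (1 + x\<^sup>2) / 2 * (sqrt (1 + x\<^sup>2) / 2) \<le> norm (z - \<i>) * norm (z + \<i>)"
    by (intro mult_mono) auto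
  then show ?thesis by (simp add: norm_one_plus_square)
qed

text \<open>Cauchy's inequality on a disc around a real point. The radius stays free, since it has
  to shrink with the exponential rate \<open>p\<close> of the integrand.\<close>

lemma deriv_norm_bound_near_real:
  assumes hol: "f holomorphic_on {z. \<bar>Im z\<bar> < 1}" and r: "0 < r" "r \<le> 1 / 2"
    and bound: "\<And>z. norm (z - of_real x) \<le> r \<Longrightarrow> norm (f z) \<le> B"
  shows "norm (deriv f (of_real x)) \<le> B / r"
proof -
  have sub: "cball (of_real x) r \<subseteq> {z. \<bar>Im z\<bar> < 1}"
  proof
    fix z assume "z \<in> cball (complex_of_real x) r"
    then have "norm (z - of_real x) \<le> 1 / 2" using r by (simp add: dist_norm norm_minus_commute)
    then show "z \<in> {z. \<bar>Im z\<bar> < 1}" using abs_Im_le_cmod[of "z - of_real x"] by simp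
  qed
  have "norm ((deriv ^^ 1) f (of_real x)) \<le> fact 1 * B / r ^ 1"
  proof (rule Cauchy_inequality)
    show "f holomorphic_on ball (of_real x) r"
      using sub hol ball_subset_cball by (meson holomorphic_on_subset order_trans)
    show "continuous_on (cball (of_real x) r) f"
      using sub hol by (meson holomorphic_on_subset holomorphic_on_imp_continuous_on)
  qed (use r bound in \<open>auto simp: norm_minus_commute\<close>)
  then show ?thesis by simp
qed

text \<open>The primitive is followed along the clockwise lower semicircle from \<open>X\<close> to
  \<open>-X\<close>, of length \<open>pi * X\<close>; the mean value inequality then replaces an
  estimate of a contour integral.\<close>

lemma norm_lower_semicircle_bound:
  assumes P: "\<And>z. Im z < 1 \<Longrightarrow> (P has_field_derivative Q z) (at z)"
    and Q: "\<And>z. Im z \<le> 0 \<Longrightarrow> norm z = X \<Longrightarrow> norm (Q z) \<le> B"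
    and X: "X > 0"
  shows "norm (P (of_real X) - P (- of_real X)) \<le> pi * X * B"
proof -
  define c where "c = (\<lambda>\<theta>. of_real X * exp (- \<i> * of_real \<theta>))"
  have c: "(c has_vector_derivative - \<i> * c \<theta>) (at \<theta>)" for \<theta>
    unfolding c_def by (rule has_vector_derivative_real_field) (auto intro!: derivative_eq_intros)
  have normc: "norm (c \<theta>) = X" for \<theta> using X by (simp add: c_def norm_mult)
  have Imc: "Im (c \<theta>) = - X * sin \<theta>" for \<theta>
    by (simp add: c_def Im_exp)
  have neg: "Im (c \<theta>) \<le> 0" if "0 \<le> \<theta>" "\<theta> \<le> pi" for \<theta>
    using that X by (simp add: Imc sin_ge_zero)
  have der: "((P \<circ> c) has_vector_derivative (- \<i> * c \<theta>) * Q (c \<theta>)) (at \<theta>)"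
    if "0 \<le> \<theta>" "\<theta> \<le> pi" for \<theta>
  proof -
    have "Im (c \<theta>) < 1" using neg[OF that] by simp
    from field_vector_diff_chain_at[OF c P[OF this]] show ?thesis by simp
  qed
  have "norm ((P \<circ> c) pi - (P \<circ> c) 0) \<le> X * B * pi - X * B * 0"
  proof (rule differentiable_bound_general[OF pi_gt_zero, where \<phi>' = "\<lambda>_. X * B"])
    show "continuous_on {0..pi} (P \<circ> c)"
      using der by (meson atLeastAtMost_iff continuous_at_imp_continuous_on has_vector_derivative_continuous)
    show "norm ((- \<i> * c \<theta>) * Q (c \<theta>)) \<le> X * B" if "0 < \<theta>" "\<theta> < pi" for \<theta>
      using Q[OF neg normc, of \<theta>] that X by (simp add: norm_mult normc)
    show "((P \<circ> c) has_vector_derivative (- \<i> * c \<theta>) * Q (c \<theta>)) (at \<theta>)" if "0 < \<theta>" "\<theta> < pi" for \<theta>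
      using der that by simp
  qed (auto intro!: continuous_intros derivative_eq_intros)
  moreover have "c pi = - of_real X" "c 0 = of_real X"
    using exp_pi_i by (simp_all add: c_def exp_minus)
  ultimately show ?thesis by (simp add: norm_minus_commute mult_ac)
qed

text \<open>Two errors are added. Truncation to \<open>[-X, X]\<close> costs \<open>1 / X\<close>,
  by the bound \<open>lower\<close> in the half plane where the path is closed; the trapezoidal rule
  costs a multiple of \<open>mesh X N * (1 + p)\<close>, by the bound \<open>strip\<close> around
  the real line. The main term is the residue contribution at \<open>-i\<close>.\<close>

lemma laplace_quadrature_bound:
  fixes g :: "complex \<Rightarrow> complex"
  assumes g: "g holomorphic_on UNIV" and p: "p \<ge> 0" and L: "L \<ge> 1"
    and lower: "\<And>z. Im z \<le> 0 \<Longrightarrow> norm (g z) \<le> G * exp (p * (- Im z))"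
    and strip: "\<And>z. \<bar>Im z\<bar> \<le> 1 \<Longrightarrow> norm (g z) \<le> G * L"
    and X: "X > 0" and N: "N > 0"
  shows "norm (trapezoid_sum X N (\<lambda>x. g (of_real x) * exp (- \<i> * of_real (x * p)) / of_real (pi * (1 + x\<^sup>2)))
             - of_real (exp (- p)) * g (- \<i>)) \<le> 16 * G * L * (mesh X N * (1 + p) + 1 / X)"
proof -
  define K where "K = (\<lambda>z. g z * exp (- \<i> * z * of_real p))"
  \<comment> \<open>subtracting \<open>k0\<close> removes the pole at \<open>-i\<close>, so that \<open>Q\<close> has a primitive on \<open>Im z < 1\<close>; the subtracted part integrates to an arctangent\<close>
  define k0 where "k0 = K (- \<i>)"
  define f where "f = (\<lambda>z. K z / (of_real pi * (1 + z\<^sup>2)))"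
  define Q where "Q = (\<lambda>z. (if z = - \<i> then deriv K (- \<i>) else (K z - K (- \<i>)) / (z - - \<i>)) / (of_real pi * (z - \<i>)))"
  let ?H = "{z. Im z < 1}" and ?S = "{z. \<bar>Im z\<bar> < 1}"
  have G: "G \<ge> 0" using lower[of 0] norm_ge_zero[of "g 0"] by (simp del: norm_ge_zero)
  have GL: "G \<le> G * L" using G L by (simp add: mult_le_cancel_left1)
  have H: "open ?H" "convex ?H"
    by (simp_all add: open_halfspace_Im_lt convex_halfspace_Im_lt)
  have S: "open ?S"
    using open_Int[OF open_halfspace_Im_lt[of 1] open_halfspace_Im_gt[of "-1"]]
    by (simp add: Int_def abs_less_iff minus_less_iff)
  have K: "K holomorphic_on A" for A
    unfolding K_def by (intro holomorphic_intros holomorphic_on_subset[OF g]) auto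
  have normK: "norm (K z) = norm (g z) * exp (p * Im z)" for z
    by (simp add: K_def norm_mult mult.commute)
  have Klow: "norm (K z) \<le> G" if "Im z \<le> 0" for z
  proof -
    have "norm (K z) \<le> G * exp (p * (- Im z)) * exp (p * Im z)"
      unfolding normK using lower[OF that] by (intro mult_right_mono) auto
    then show ?thesis by (simp add: mult.assoc flip: exp_add)
  qed
  have k0: "norm k0 \<le> G" "k0 = of_real (exp (- p)) * g (- \<i>)"
    using Klow[of "- \<i>"] by (simp_all add: k0_def) (simp add: K_def exp_of_real mult.commute flip: of_real_minus)
  have nz: "1 + z\<^sup>2 \<noteq> 0" if "\<bar>Im z\<bar> < 1" for z :: complex
  proof -
    have "z - \<i> \<noteq> 0" "z + \<i> \<noteq> 0" using that by (auto simp: complex_eq_iff)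
    then have "norm (1 + z\<^sup>2) \<noteq> 0" by (simp add: norm_one_plus_square)
    then show ?thesis by auto
  qed
  have fhol: "f holomorphic_on ?S"
    unfolding f_def by (intro holomorphic_intros K) (use nz in auto)
  have Qhol: "Q holomorphic_on ?H"
    unfolding Q_def by (intro holomorphic_intros pole_lemma_open K H) auto
  obtain P where P: "\<And>z. Im z < 1 \<Longrightarrow> (P has_field_derivative Q z) (at z)"
    using holomorphic_convex_primitive'[OF H(2,1) Qhol] H(1) by (metis at_within_open mem_Collect_eq)
  have Qeq: "Q z = (K z - k0) / (of_real pi * (1 + z\<^sup>2))" if "z \<noteq> - \<i>" for z
  proof -
    have "1 + z\<^sup>2 = (z - \<i>) * (z + \<i>)" by (simp add: algebra_simps power2_eq_square)
    then show ?thesis using that by (simp add: Q_def k0_def mult_ac)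
  qed
  have Qlow: "norm (Q z) \<le> 2 * G / (pi * norm (1 + z\<^sup>2))" if "Im z \<le> 0" "z \<noteq> - \<i>" for z
  proof -
    have "norm (K z - k0) \<le> 2 * G"
      using norm_triangle_ineq4[of "K z" k0] Klow[OF that(1)] k0 by linarith
    then show ?thesis using that by (simp add: Qeq norm_divide norm_mult divide_right_mono)
  qed
  define F where "F = (\<lambda>x. P (of_real x) + k0 * of_real (arctan x / pi))"
  define f' where "f' = (\<lambda>x. deriv f (of_real x :: complex))"
  have nrm: "norm (1 + (complex_of_real x)\<^sup>2) = 1 + x\<^sup>2" for x
  proof -
    have "1 + (complex_of_real x)\<^sup>2 = of_real (1 + x\<^sup>2)" by simp
    then show ?thesis by (simp only: norm_of_real) simp
  qed
  have F: "(F has_vector_derivative f (of_real x)) (at x)" for x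
  proof -
    have "((\<lambda>x. P (of_real x)) has_vector_derivative Q (of_real x)) (at x)"
      by (rule has_vector_derivative_real_field) (rule P, simp)
    moreover have "((\<lambda>x. k0 * of_real (arctan x / pi)) has_vector_derivative k0 * of_real (inverse (1 + x\<^sup>2) / pi)) (at x)"
      by (intro has_vector_derivative_mult_right has_vector_derivative_of_real)
         (auto intro!: derivative_eq_intros simp flip: has_real_derivative_iff_has_vector_derivative)
    ultimately have "(F has_vector_derivative Q (of_real x) + k0 * of_real (inverse (1 + x\<^sup>2) / pi)) (at x)"
      unfolding F_def by (rule has_vector_derivative_add)
    moreover have "complex_of_real x \<noteq> - \<i>" by (simp add: complex_eq_iff)
    then have "Q (of_real x) + k0 * of_real (inverse (1 + x\<^sup>2) / pi) = f (of_real x)"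
      by (simp add: Qeq f_def field_simps flip: add_divide_distrib)
    ultimately show ?thesis by simp
  qed
  have f': "((\<lambda>x. f (of_real x)) has_vector_derivative f' x) (at x)" for x
    unfolding f'_def
    by (rule has_vector_derivative_real_field) (rule holomorphic_derivI[OF fhol S], simp)
  have f'_bound: "norm (f' x) \<le> 8 * G * L * (1 + p) / (1 + x\<^sup>2)" for x
  proof -
    \<comment> \<open>With this radius \<open>p * Im z \<le> 1/2\<close>, so the exponential factor
      is at most 2 on the disc; also \<open>?r \<le> 1/2\<close> keeps the disc away from the poles.
      Dividing by it produces the factor \<open>1 + p\<close>.\<close>
    let ?r = "1 / (2 * (1 + p))"
    have r: "0 < ?r" "?r \<le> 1 / 2" using p by (auto simp: field_simps)
    have "norm (f z) \<le> 4 * G * L / (1 + x\<^sup>2)" if z: "norm (z - of_real x) \<le> ?r" for z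
    proof -
      have Imz: "\<bar>Im z\<bar> \<le> ?r" using abs_Im_le_cmod[of "z - of_real x"] z by simp
      have "p * Im z \<le> p * ?r" using Imz p by (intro mult_left_mono) auto
      also have "\<dots> \<le> 1 / 2" using p by (simp add: field_simps)
      finally have "exp (p * Im z) \<le> exp (1 / 2)" by simp
      also have "\<dots> \<le> 2" using exp_half_le2 by simp
      finally have "norm (K z) \<le> G * L * 2"
        unfolding normK using strip[of z] Imz r G L by (intro mult_mono) auto
      moreover have "2 * ((1 + x\<^sup>2) / 4) \<le> pi * norm (1 + z\<^sup>2)"
        using norm_one_plus_square_ge[of z x] z r pi_ge_two by (intro mult_mono) auto
      ultimately have "norm (f z) \<le> G * L * 2 / (2 * ((1 + x\<^sup>2) / 4))"
        unfolding f_def norm_divide norm_mult using G L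
        by (intro frac_le) (auto simp: norm_mult add_pos_nonneg)
      also have "G * L * 2 / (2 * ((1 + x\<^sup>2) / 4)) = 4 * G * L / (1 + x\<^sup>2)"
        by (simp add: divide_simps add_nonneg_eq_0_iff)
      finally show ?thesis .
    qed
    from deriv_norm_bound_near_real[OF fhol r this]
    have "norm (f' x) \<le> 4 * G * L / (1 + x\<^sup>2) / ?r" by (simp add: f'_def)
    then show ?thesis using p by (simp add: mult_ac)
  qed
  have trap: "norm (trapezoid_sum X N (\<lambda>x. f (of_real x)) - (F X - F (- X))) \<le> 2 * mesh X N * (8 * G * L * (1 + p))"
    by (rule trapezoid_sum_bound[OF X N F f' f'_bound])
  \<comment> \<open>For \<open>X \<ge> 2\<close> the semicircle avoids \<open>-i\<close> and
    \<open>norm (1 + z^2) \<ge> X^2 / 2\<close> on it. For smaller \<open>X\<close> it may pass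
    through or near \<open>-i\<close>, but \<open>1 / X > 1/2\<close> then, and integrating along
    the real segment gives the bound \<open>2 * G\<close>, which is enough.\<close>
  have PX: "norm (P (of_real X) - P (- of_real X)) \<le> 4 * G / X"
  proof (cases "X \<ge> 2")
    case True
    have "norm (Q z) \<le> 4 * G / (pi * X\<^sup>2)" if "Im z \<le> 0" "norm z = X" for z
    proof -
      have "1 \<le> X\<^sup>2 / 2" using True power_mono[of 2 X 2] by simp
      moreover have "X\<^sup>2 - 1 \<le> norm (1 + z\<^sup>2)"
        using norm_triangle_ineq2[of "z\<^sup>2" "-1"] that by (simp add: norm_power add.commute)
      ultimately have n: "X\<^sup>2 / 2 \<le> norm (1 + z\<^sup>2)" by linarith
      have "z \<noteq> - \<i>" using that True by auto
      then have "norm (Q z) \<le> 2 * G / (pi * norm (1 + z\<^sup>2))" using Qlow that by blast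
      also have "\<dots> \<le> 2 * G / (pi * (X\<^sup>2 / 2))"
        using n G X by (intro divide_left_mono mult_left_mono mult_pos_pos) (auto intro: order.strict_trans2[OF _ n])
      finally show ?thesis by simp
    qed
    with norm_lower_semicircle_bound[OF P _ X]
    have "norm (P (of_real X) - P (- of_real X)) \<le> pi * X * (4 * G / (pi * X\<^sup>2))" by blast
    also have "\<dots> = 4 * G / X" using X by (simp add: divide_simps power2_eq_square)
    finally show ?thesis .
  next
    case False
    have "norm (P (of_real X) - P (of_real (- X))) \<le> 2 * G / pi * (arctan X - arctan (- X))"
    proof (rule has_vector_derivative_arctan_bound)
      show "((\<lambda>x. P (of_real x)) has_vector_derivative Q (of_real x)) (at x)" for x
        by (rule has_vector_derivative_real_field) (rule P, simp)
      show "norm (Q (of_real x)) \<le> 2 * G / pi / (1 + x\<^sup>2)" for x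
        using Qlow[of "of_real x"] by (simp add: nrm complex_eq_iff)
    qed (use X in simp)
    also have "\<dots> \<le> 2 * G / pi * pi"
      using arctan_ubound[of X] G by (intro mult_left_mono) (auto simp: arctan_minus)
    also have "\<dots> \<le> 4 * G / X" using False X G mult_right_mono[of X 2 G] by (simp add: field_simps)
    finally show ?thesis by simp
  qed
  \<comment> \<open>Over the whole line the arctangent part would contribute exactly
    \<open>k0\<close>. The two missing tails are
    \<open>pi / 2 - arctan X = arctan (1 / X) \<le> 1 / X\<close> each.\<close>
  have FX: "norm (F X - F (- X) - k0) \<le> 5 * G / X"
  proof -
    have at: "pi / 2 - arctan X \<ge> 0" "pi / 2 - arctan X \<le> 1 / X"
      using arctan_ubound[of X] arctan_inverse[OF X] arctan_le_self[of "inverse X"] X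
      by (auto simp: inverse_eq_divide)
    have "F X - F (- X) - k0 = (P (of_real X) - P (- of_real X)) - k0 * of_real ((pi / 2 - arctan X) * (2 / pi))"
      by (simp add: F_def arctan_minus field_simps)
    also have "norm \<dots> \<le> 4 * G / X + norm k0 * ((pi / 2 - arctan X) * (2 / pi))"
      using norm_triangle_ineq4 PX at by (smt (verit) norm_mult norm_of_real abs_of_nonneg mult_nonneg_nonneg pi_ge_zero divide_nonneg_nonneg)
    also have "\<dots> \<le> 4 * G / X + G * (1 / X * 1)"
      using k0 at pi_ge_two G X by (intro add_left_mono mult_mono) auto
    finally show ?thesis by (simp add: field_simps)
  qed
  have "norm (trapezoid_sum X N (\<lambda>x. f (of_real x)) - k0) \<le> 2 * mesh X N * (8 * G * L * (1 + p)) + 5 * G / X"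
    using norm_triangle_ineq[of "trapezoid_sum X N (\<lambda>x. f (of_real x)) - (F X - F (- X))" "F X - F (- X) - k0"] trap FX
    by simp
  also have "\<dots> \<le> 2 * mesh X N * (8 * G * L * (1 + p)) + 16 * (G * L) / X"
    using GL G X by (intro add_left_mono divide_right_mono) auto
  also have "\<dots> = 16 * G * L * (mesh X N * (1 + p) + 1 / X)" by (simp add: algebra_simps)
  finally show ?thesis by (simp add: f_def K_def k0(2) mult.assoc)
qed

section \<open>Linear differential equations with a holomorphic parameter\<close>

lemma norm_vector_smult: "norm (c *s x) = norm c * norm x"
  for c :: complex and x :: "complex^'n"
  by (simp add: norm_vec_def norm_mult L2_set_right_distrib)

lemma norm_matrix_vector_mult_le: "norm (M *v x) \<le> norm M * norm x"
  for M :: "complex^'n^'m"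
proof -
  have "norm ((M *v x) $ a) \<le> norm (M $ a) * norm x" for a
  proof -
    have "norm ((M *v x) $ a) \<le> (\<Sum>b\<in>UNIV. norm (M $ a $ b) * norm (x $ b))"
      unfolding matrix_vector_mult_def by (simp add: sum_norm_le norm_mult)
    also have "\<dots> \<le> norm (M $ a) * norm x"
      using L2_set_mult_ineq[where A = UNIV and f = "\<lambda>b. norm (M $ a $ b)" and g = "\<lambda>b. norm (x $ b)"]
      by (simp add: norm_vec_def)
    finally show ?thesis .
  qed
  then have "norm (M *v x) \<le> L2_set (\<lambda>a. norm (M $ a) * norm x) UNIV"
    unfolding norm_vec_def[of "M *v x"] by (intro L2_set_mono) auto
  also have "\<dots> = norm M * norm x"
    by (simp add: norm_vec_def[of M] L2_set_left_distrib)
  finally show ?thesis .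
qed

lemma bounded_bilinear_matrix_vector_mult:
  "bounded_bilinear ((*v) :: complex^'n^'m \<Rightarrow> complex^'n \<Rightarrow> complex^'m)"
proof (unfold_locales, goal_cases)
  case (1 a a' b) show ?case by (rule matrix_vector_mult_add_rdistrib)
next
  case (2 a b b') show ?case by (rule matrix_vector_right_distrib)
next
  case (3 r a b) show ?case
    by (simp add: matrix_vector_mult_def vec_eq_iff scaleR_sum_right)
next
  case (4 a r b) show ?case
    by (simp add: matrix_vector_mult_def vec_eq_iff scaleR_sum_right)
next
  case 5 show ?case
    by (rule exI[of _ 1]) (simp add: norm_matrix_vector_mult_le)
qed

lemmas continuous_on_matrix_vector_mult =
  bounded_bilinear.continuous_on[OF bounded_bilinear_matrix_vector_mult]

lemma bounded_linear_vector_smult: "bounded_linear ((*s) (c :: complex) :: complex^'n \<Rightarrow> _)"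
proof (rule bounded_linear_intro[where K = "norm c"])
  fix x y :: "complex^'n" and r
  show "c *s (x + y) = c *s x + c *s y" by (rule vector_add_ldistrib)
  show "c *s (r *\<^sub>R x) = r *\<^sub>R (c *s x)" by (simp add: vec_eq_iff)
  show "norm (c *s x) \<le> norm x * norm c" by (simp add: norm_vector_smult mult.commute)
qed

lemmas continuous_on_vector_smult =
  bounded_linear.continuous_on[OF bounded_linear_vector_smult]

section \<open>Affine matrix pencils and the Dyson series\<close>

definition pencil_apply :: "complex^'n^'n \<Rightarrow> complex^'n^'n \<Rightarrow> complex \<Rightarrow> complex^'n \<Rightarrow> complex^'n" where
  "pencil_apply P Q z v = P *v v + z *s (Q *v v)"

lemma pencil_apply_diff: "pencil_apply P Q z (v - w) = pencil_apply P Q z v - pencil_apply P Q z w"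
  by (simp add: pencil_apply_def matrix_vector_mult_diff_distrib vector_ssub_ldistrib)

lemma pencil_apply_sum:
  fixes v :: "'b \<Rightarrow> complex^'n"
  shows "pencil_apply P Q z (\<Sum>i\<in>I. v i) = (\<Sum>i\<in>I. pencil_apply P Q z (v i))"
proof -
  interpret bounded_linear "(*v) R" for R :: "complex^'n^'n"
    by (rule bounded_bilinear.bounded_linear_right[OF bounded_bilinear_matrix_vector_mult])
  have "z *s (\<Sum>i\<in>I. w i) = (\<Sum>i\<in>I. z *s w i)" for w :: "'b \<Rightarrow> complex^'n"
    by (rule linear_sum[OF bounded_linear.linear[OF bounded_linear_vector_smult]])
  then show ?thesis by (simp add: pencil_apply_def sum sum.distrib)
qed

lemma norm_pencil_apply_le:
  assumes "norm P \<le> M" "norm Q \<le> M" "norm z \<le> r"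
  shows "norm (pencil_apply P Q z v) \<le> M * (1 + r) * norm v"
proof -
  have M: "0 \<le> M" using assms(1) norm_ge_zero order_trans by blast
  have "norm (pencil_apply P Q z v) \<le> norm P * norm v + norm z * (norm Q * norm v)"
    unfolding pencil_apply_def
    by (intro order_trans[OF norm_triangle_ineq] add_mono)
       (auto simp: norm_vector_smult norm_matrix_vector_mult_le mult_left_mono)
  also have "\<dots> \<le> M * norm v + r * (M * norm v)"
    using assms M by (intro add_mono mult_mono mult_nonneg_nonneg) (auto intro: order_trans[OF norm_ge_zero])
  finally show ?thesis by (simp add: algebra_simps)
qed

lemma continuous_on_pencil_apply:
  assumes "continuous_on S P" "continuous_on S Q" "continuous_on S v"
  shows "continuous_on S (\<lambda>t. pencil_apply (P t) (Q t) z (v t))"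
  unfolding pencil_apply_def
  by (intro continuous_on_add continuous_on_vector_smult continuous_on_matrix_vector_mult assms)

text \<open>These are the summands of the Dyson series, that is, the differences of successive
  Picard iterates; the derivative of each summand is the pencil applied to the previous one.\<close>

primrec dyson_term ::
  "(real \<Rightarrow> complex^'n^'n) \<Rightarrow> (real \<Rightarrow> complex^'n^'n) \<Rightarrow> complex^'n \<Rightarrow> nat \<Rightarrow> complex \<Rightarrow> real \<Rightarrow> complex^'n"
where
  "dyson_term P Q u0 0 z t = u0"
| "dyson_term P Q u0 (Suc k) z t = integral {0..t} (\<lambda>s. pencil_apply (P s) (Q s) z (dyson_term P Q u0 k z s))"

lemma continuous_on_Icc_norm_bound:
  fixes P :: "real \<Rightarrow> 'a::real_normed_vector"
  assumes "continuous_on {a..b} P"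
  obtains M where "M \<ge> 0" "\<And>t. t \<in> {a..b} \<Longrightarrow> norm (P t) \<le> M"
proof -
  obtain M where M: "\<forall>x\<in>P ` {a..b}. norm x \<le> M"
    using compact_imp_bounded[OF compact_continuous_image[OF assms]] unfolding bounded_iff by blast
  show ?thesis
  proof (rule that[of "max 0 M"])
    show "norm (P t) \<le> max 0 M" if "t \<in> {a..b}" for t
      using M that by (simp add: le_max_iff_disj)
  qed simp
qed

context
  fixes P Q :: "real \<Rightarrow> complex^'n^'n" and T :: real and u0 :: "complex^'n"
  assumes T: "T > 0" and P: "continuous_on {0..T} P" and Q: "continuous_on {0..T} Q"
begin

lemma pencil_norm_bound:
  obtains M where "M \<ge> 0"
    "\<And>t. t \<in> {0..T} \<Longrightarrow> norm (P t) \<le> M" "\<And>t. t \<in> {0..T} \<Longrightarrow> norm (Q t) \<le> M"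
proof -
  obtain M1 M2 where M: "M1 \<ge> 0" "\<And>t. t \<in> {0..T} \<Longrightarrow> norm (P t) \<le> M1" "\<And>t. t \<in> {0..T} \<Longrightarrow> norm (Q t) \<le> M2"
    using continuous_on_Icc_norm_bound[OF P] continuous_on_Icc_norm_bound[OF Q] by metis
  show ?thesis
  proof (rule that[of "max M1 M2"])
    show "max M1 M2 \<ge> 0" using M by simp
  qed (use M in \<open>auto simp: le_max_iff_disj\<close>)
qed

text \<open>Each integration follows an application of a pencil affine in \<open>z\<close>, so the
  degree in \<open>z\<close> rises by at most one. The polynomial form yields continuity in
  \<open>t\<close> and holomorphy in \<open>z\<close> at once, without differentiating under the
  integral sign.\<close>

lemma dyson_term_polynomial:
  "\<exists>c. (\<forall>j. continuous_on {0..T} (c j)) \<and>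
     (\<forall>z. \<forall>t\<in>{0..T}. dyson_term P Q u0 k z t = (\<Sum>j\<le>k. z ^ j *s c j t))"
proof (induction k)
  case 0
  show ?case by (rule exI[of _ "\<lambda>_ _. u0"]) simp
next
  case (Suc k)
  then obtain c where c: "\<And>j. continuous_on {0..T} (c j)"
    and eq: "\<And>z t. t \<in> {0..T} \<Longrightarrow> dyson_term P Q u0 k z t = (\<Sum>j\<le>k. z ^ j *s c j t)" by blast
  \<comment> \<open>The coefficient of \<open>z^j\<close> collects \<open>P\<close> times the old
    coefficient \<open>j\<close> and \<open>Q\<close> times the old coefficient
    \<open>j - 1\<close>. The guards matter: \<open>c j\<close> is arbitrary for
    \<open>j > k\<close>, and \<open>0 - 1 = 0\<close> on naturals.\<close>
  define d where "d = (\<lambda>j s. (if j \<le> k then P s *v c j s else 0) + (if j = 0 then 0 else Q s *v c (j - 1) s))"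
  have d: "continuous_on {0..T} (d j)" for j
  proof -
    have "continuous_on {0..T} (\<lambda>s. R s *v c i s)" if "continuous_on {0..T} R" for R :: "real \<Rightarrow> complex^'n^'n" and i
      by (intro continuous_on_matrix_vector_mult that c)
    from continuous_on_add[OF this[OF P] this[OF Q]] this[OF P] this[OF Q] show ?thesis
      unfolding d_def by (cases "j \<le> k"; cases "j = 0") simp_all
  qed
  have integrand: "pencil_apply (P s) (Q s) z (dyson_term P Q u0 k z s) = (\<Sum>j\<le>Suc k. z ^ j *s d j s)"
    if "s \<in> {0..T}" for s z
  proof -
    have mv: "R *v (x *s v) = x *s (R *v v)" for R :: "complex^'n^'n" and x v
      by (simp add: matrix_vector_mult_def vec_eq_iff sum_distrib_left mult_ac)
    have "(\<Sum>j\<le>Suc k. z ^ j *s d j s) =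
        (\<Sum>j\<le>k. z ^ j *s (P s *v c j s)) + (\<Sum>j\<le>Suc k. z ^ j *s (if j = 0 then 0 else Q s *v c (j - 1) s))"
      unfolding d_def by (simp add: vector_add_ldistrib sum.distrib)
    also have "(\<Sum>j\<le>Suc k. z ^ j *s (if j = 0 then 0 else Q s *v c (j - 1) s)) = (\<Sum>j\<le>k. z ^ Suc j *s (Q s *v c j s))"
      by (subst sum.atMost_Suc_shift) simp
    finally show ?thesis
      unfolding eq[OF that] pencil_apply_sum by (simp add: pencil_apply_def mv sum.distrib vector_smult_assoc mult.commute)
  qed
  show ?case
  proof (intro exI[of _ "\<lambda>j t. integral {0..t} (d j)"] conjI allI ballI)
    show "continuous_on {0..T} (\<lambda>t. integral {0..t} (d j))" for j
      using d by (intro indefinite_integral_continuous_1 integrable_continuous_real)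
    fix z t assume t: "t \<in> {0..T}"
    then have dt: "d j integrable_on {0..t}" for j
      by (intro integrable_continuous_real continuous_on_subset[OF d]) auto
    have sm: "integral {0..t} (\<lambda>s. x *s d j s) = x *s integral {0..t} (d j)" for x j
      using integral_linear[OF dt bounded_linear_vector_smult] by (simp add: o_def)
    have "dyson_term P Q u0 (Suc k) z t = integral {0..t} (\<lambda>s. \<Sum>j\<le>Suc k. z ^ j *s d j s)"
      unfolding dyson_term.simps using t by (intro integral_cong integrand) auto
    also have "\<dots> = (\<Sum>j\<le>Suc k. integral {0..t} (\<lambda>s. z ^ j *s d j s))"
      using integrable_linear[OF dt bounded_linear_vector_smult] by (intro integral_sum) (auto simp: o_def)
    finally show "dyson_term P Q u0 (Suc k) z t = (\<Sum>j\<le>Suc k. z ^ j *s integral {0..t} (d j))"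
      by (simp only: sm)
  qed
qed

lemma continuous_on_dyson_term: "continuous_on {0..T} (dyson_term P Q u0 k z)"
proof -
  obtain c where c: "\<And>j. continuous_on {0..T} (c j)"
    and eq: "\<And>z t. t \<in> {0..T} \<Longrightarrow> dyson_term P Q u0 k z t = (\<Sum>j\<le>k. z ^ j *s c j t)"
    using dyson_term_polynomial[of k] by blast
  have "continuous_on {0..T} (\<lambda>t. \<Sum>j\<le>k. z ^ j *s c j t)"
    by (intro continuous_on_sum continuous_on_vector_smult c)
  then show ?thesis using eq by (subst continuous_on_cong[OF refl]) auto
qed

lemma holomorphic_on_dyson_term:
  assumes "t \<in> {0..T}"
  shows "(\<lambda>z. dyson_term P Q u0 k z t $ a) holomorphic_on S"
proof -
  obtain c where eq: "\<And>z t. t \<in> {0..T} \<Longrightarrow> dyson_term P Q u0 k z t = (\<Sum>j\<le>k. z ^ j *s c j t)"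
    using dyson_term_polynomial[of k] by blast
  have "(\<lambda>z. \<Sum>j\<le>k. z ^ j * (c j t $ a)) holomorphic_on S"
    by (intro holomorphic_intros)
  then show ?thesis by (simp add: eq[OF assms] sum_component)
qed

lemma dyson_term_has_vector_derivative:
  assumes "t \<in> {0..T}"
  shows "(dyson_term P Q u0 (Suc k) z has_vector_derivative
     pencil_apply (P t) (Q t) z (dyson_term P Q u0 k z t)) (at t within {0..T})"
  unfolding dyson_term.simps[abs_def]
  by (rule integral_has_vector_derivative[OF _ assms])
     (intro continuous_on_pencil_apply P Q continuous_on_dyson_term)

text \<open>The derivative of the majorant for \<open>Suc k\<close> is \<open>M * (1 + r)\<close>
  times the majorant for \<open>k\<close>, which is also what the pencil bound gives for the
  derivative of the term; both vanish at 0.\<close>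

lemma norm_dyson_term_le:
  assumes M: "\<And>t. t \<in> {0..T} \<Longrightarrow> norm (P t) \<le> M" "\<And>t. t \<in> {0..T} \<Longrightarrow> norm (Q t) \<le> M"
    and z: "norm z \<le> r" and "t \<in> {0..T}"
  shows "norm (dyson_term P Q u0 k z t) \<le> (M * (1 + r) * t) ^ k / fact k * norm u0"
  using \<open>t \<in> {0..T}\<close>
proof (induction k arbitrary: t)
  case (Suc k)
  show ?case
  proof (cases "t = 0")
    case False
    let ?K = "M * (1 + r)" and ?D = "dyson_term P Q u0"
    have t: "0 < t" "t \<le> T" using Suc.prems False by auto
    have K: "0 \<le> ?K"
      using order_trans[OF norm_ge_zero M(1)[of 0]] order_trans[OF norm_ge_zero z] T by simp
    have "norm (?D (Suc k) z t - ?D (Suc k) z 0) \<le>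
        (?K * t) ^ Suc k / fact (Suc k) * norm u0 - (?K * 0) ^ Suc k / fact (Suc k) * norm u0"
    proof (rule differentiable_bound_general[OF t(1)])
      show "continuous_on {0..t} (?D (Suc k) z)"
        using t by (intro continuous_on_subset[OF continuous_on_dyson_term]) auto
      show "(?D (Suc k) z has_vector_derivative pencil_apply (P x) (Q x) z (?D k z x)) (at x)"
        if "0 < x" "x < t" for x
        using dyson_term_has_vector_derivative[of x k z] that t by (simp add: at_within_Icc_at)
      show "((\<lambda>x. (?K * x) ^ Suc k / fact (Suc k) * norm u0) has_vector_derivative ?K * ((?K * x) ^ k / fact k * norm u0)) (at x)" for x
      proof -
        have "((\<lambda>x. (?K * x) ^ Suc k) has_real_derivative real (Suc k) * (?K * x) ^ k * ?K) (at x)"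
          using DERIV_power_Suc[OF DERIV_cmult_Id[of ?K x UNIV], of k] by (simp add: mult_ac)
        from DERIV_cmult[OF this, of "norm u0 / fact (Suc k)"]
        have "((\<lambda>x. (?K * x) ^ Suc k / fact (Suc k) * norm u0) has_real_derivative
            norm u0 / fact (Suc k) * (real (Suc k) * (?K * x) ^ k * ?K)) (at x)" by (simp add: mult_ac)
        also have "norm u0 / fact (Suc k) * (real (Suc k) * (?K * x) ^ k * ?K) = ?K * ((?K * x) ^ k / fact k * norm u0)"
          by (simp only: fact_Suc of_nat_mult) simp
        finally show ?thesis by (simp only: has_real_derivative_iff_has_vector_derivative)
      qed
      show "norm (pencil_apply (P x) (Q x) z (?D k z x)) \<le> ?K * ((?K * x) ^ k / fact k * norm u0)"
        if "0 < x" "x < t" for x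
      proof -
        have x: "x \<in> {0..T}" using that t by simp
        have "norm (pencil_apply (P x) (Q x) z (?D k z x)) \<le> ?K * norm (?D k z x)"
          by (rule norm_pencil_apply_le[OF M[OF x] z])
        also have "\<dots> \<le> ?K * ((?K * x) ^ k / fact k * norm u0)"
          by (rule mult_left_mono[OF Suc.IH[OF x] K])
        finally show ?thesis .
      qed
    qed (auto intro!: continuous_intros)
    then show ?thesis by simp
  qed simp
qed simp

text \<open>Uniformity in the pair \<open>(t, z)\<close> serves twice: with \<open>z\<close> fixed
  it permits termwise differentiation in \<open>t\<close>, with \<open>t\<close> fixed it passes
  holomorphy in \<open>z\<close> to the limit.\<close>

lemma uniform_limit_dyson_series:
  fixes r :: real
  shows "uniform_limit ({0..T} \<times> cball 0 r) (\<lambda>n (t, z). \<Sum>k<n. dyson_term P Q u0 k z t)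
     (\<lambda>(t, z). \<Sum>k. dyson_term P Q u0 k z t) sequentially"
proof -
  obtain M where M0: "M \<ge> 0"
    and M: "\<And>t. t \<in> {0..T} \<Longrightarrow> norm (P t) \<le> M" "\<And>t. t \<in> {0..T} \<Longrightarrow> norm (Q t) \<le> M"
    using pencil_norm_bound by blast
  have "uniform_limit ({0..T} \<times> cball 0 r) (\<lambda>n y. \<Sum>k<n. dyson_term P Q u0 k (snd y) (fst y))
     (\<lambda>y. \<Sum>k. dyson_term P Q u0 k (snd y) (fst y)) sequentially"
  proof (rule Weierstrass_m_test)
    show "summable (\<lambda>k. (M * (1 + r) * T) ^ k / fact k * norm u0)"
      using summable_exp_generic[of "M * (1 + r) * T"]
      by (intro summable_mult2) (simp add: divide_inverse mult.commute)
    fix k and y :: "real \<times> complex" assume y: "y \<in> {0..T} \<times> cball 0 r"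
    then have r: "0 \<le> r" using order_trans[OF norm_ge_zero, of "snd y" r] by (simp add: mem_Times_iff)
    have "norm (dyson_term P Q u0 k (snd y) (fst y)) \<le> (M * (1 + r) * fst y) ^ k / fact k * norm u0"
      using y by (intro norm_dyson_term_le M) auto
    also have "\<dots> \<le> (M * (1 + r) * T) ^ k / fact k * norm u0"
      using y M0 r by (intro mult_right_mono divide_right_mono power_mono mult_left_mono) auto
    finally show "norm (dyson_term P Q u0 k (snd y) (fst y)) \<le> (M * (1 + r) * T) ^ k / fact k * norm u0" .
  qed
  then show ?thesis by (simp add: case_prod_unfold)
qed

lemma linear_ode_holomorphic_solution:
  obtains V :: "complex \<Rightarrow> real \<Rightarrow> complex^'n" where
    "\<And>z. V z 0 = u0"
    "\<And>z t. t \<in> {0..T} \<Longrightarrow> (V z has_vector_derivative pencil_apply (P t) (Q t) z (V z t)) (at t within {0..T})"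
    "\<And>t a. t \<in> {0..T} \<Longrightarrow> (\<lambda>z. V z t $ a) holomorphic_on UNIV"
proof
  let ?D = "dyson_term P Q u0"
  define V where "V = (\<lambda>z t. \<Sum>k. ?D k z t)"
  define S where "S = (\<lambda>n z t. \<Sum>k<n. ?D k z t)"
  have lim_t: "uniform_limit {0..T} (\<lambda>n. S n z) (V z) sequentially" for z
    using uniform_limit_compose'[OF uniform_limit_dyson_series[of "norm z"], of "\<lambda>t. (t, z)" "{0..T}"]
    by (simp add: V_def S_def)
  have lim_z: "uniform_limit (cball 0 r) (\<lambda>n z. S n z t) (\<lambda>z. V z t) sequentially" if "t \<in> {0..T}" for r t
    using uniform_limit_compose'[OF uniform_limit_dyson_series[of r], of "\<lambda>z. (t, z)" "cball 0 r"] that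
    by (simp add: V_def S_def)
  show V0: "V z 0 = u0" for z
  proof -
    have "?D k z 0 = 0" if "k \<notin> {0}" for k using that by (cases k) auto
    then show ?thesis unfolding V_def by (subst suminf_finite[of "{0}"]) auto
  qed
  show "(\<lambda>z. V z t $ a) holomorphic_on UNIV" if t: "t \<in> {0..T}" for t a
  proof (rule holomorphic_uniform_sequence[where f = "\<lambda>n z. S n z t $ a"])
    show "(\<lambda>z. S n z t $ a) holomorphic_on UNIV" for n
      unfolding S_def sum_component by (intro holomorphic_intros holomorphic_on_dyson_term t)
    show "\<exists>d>0. cball x d \<subseteq> UNIV \<and> uniform_limit (cball x d) (\<lambda>n z. S n z t $ a) (\<lambda>z. V z t $ a) sequentially" for x
    proof (intro exI[of _ 1] conjI)
      have "cball x 1 \<subseteq> cball 0 (norm x + 1)" by (simp add: cball_subset_cball_iff)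
      then show "uniform_limit (cball x 1) (\<lambda>n z. S n z t $ a) (\<lambda>z. V z t $ a) sequentially"
        by (intro bounded_linear.uniform_limit[OF bounded_linear_vec_nth] uniform_limit_on_subset[OF lim_z[OF t]])
    qed auto
  qed auto
  fix z t assume t: "t \<in> {0..T}"
  obtain K where K: "K > 0" "\<And>t v. t \<in> {0..T} \<Longrightarrow> norm (pencil_apply (P t) (Q t) z v) \<le> K * norm v"
  proof -
    obtain M where M: "M \<ge> 0" "\<And>t. t \<in> {0..T} \<Longrightarrow> norm (P t) \<le> M" "\<And>t. t \<in> {0..T} \<Longrightarrow> norm (Q t) \<le> M"
      using pencil_norm_bound by blast
    show ?thesis
    proof (rule that[of "M * (1 + norm z) + 1"])
      \<comment> \<open>The summand 1 makes the constant positive even if both coefficients vanish,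
        so that \<open>e / K\<close> is a legitimate tolerance below.\<close>
      show "0 < M * (1 + norm z) + 1" using M(1) by (simp add: add_nonneg_pos)
      show "norm (pencil_apply (P t) (Q t) z v) \<le> (M * (1 + norm z) + 1) * norm v" if "t \<in> {0..T}" for t v
        using norm_pencil_apply_le[OF M(2,3)[OF that] order_refl, of z v]
        by (simp add: distrib_right add_increasing2)
    qed
  qed
  have "\<exists>g. \<forall>x\<in>{0..T}. (\<lambda>k. ?D k z x) sums g x \<and>
      (g has_derivative (\<lambda>h. h *\<^sub>R pencil_apply (P x) (Q x) z (V z x))) (at x within {0..T})"
  proof (rule has_derivative_series)
    show "(?D k z has_derivative (\<lambda>h. h *\<^sub>R (case k of 0 \<Rightarrow> 0 | Suc m \<Rightarrow> pencil_apply (P x) (Q x) z (?D m z x)))) (at x within {0..T})"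
      if "x \<in> {0..T}" for k x
    proof (cases k)
      case 0
      then show ?thesis by (simp add: dyson_term.simps[abs_def])
    next
      case (Suc m)
      then show ?thesis using dyson_term_has_vector_derivative[OF that, of m z]
        by (simp add: has_vector_derivative_def)
    qed
    fix e :: real assume "e > 0"
    then have "\<forall>\<^sub>F n in sequentially. \<forall>x\<in>{0..T}. dist (S n z x) (V z x) < e / K"
      using K by (intro uniform_limitD[OF lim_t]) auto
    \<comment> \<open>The first term of the series is constant and each later derivative is the
      pencil applied to the preceding term. Hence \<open>Suc n\<close> derivatives add up to the
      pencil applied to \<open>S n\<close>, and the index is shifted back afterwards.\<close>
    then have "\<forall>\<^sub>F n in sequentially. \<forall>x\<in>{0..T}. \<forall>h. norm ((\<Sum>i<Suc n. h *\<^sub>R (case i of 0 \<Rightarrow> 0 | Suc m \<Rightarrow> pencil_apply (P x) (Q x) z (?D m z x)))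
        - h *\<^sub>R pencil_apply (P x) (Q x) z (V z x)) \<le> e * norm h"
    proof eventually_elim
      case (elim n)
      show ?case
      proof (intro ballI allI)
        fix x h assume x: "x \<in> {0..T}"
        let ?L = "pencil_apply (P x) (Q x) z"
        have "(\<Sum>i<Suc n. h *\<^sub>R (case i of 0 \<Rightarrow> 0 | Suc m \<Rightarrow> ?L (?D m z x))) - h *\<^sub>R ?L (V z x) = h *\<^sub>R ?L (S n z x - V z x)"
          by (subst sum.lessThan_Suc_shift) (simp add: S_def pencil_apply_diff pencil_apply_sum scaleR_right_diff_distrib scaleR_sum_right)
        also have "norm \<dots> \<le> \<bar>h\<bar> * (K * norm (S n z x - V z x))"
          using K(2)[OF x] by (simp add: mult_left_mono)
        also have "\<dots> \<le> \<bar>h\<bar> * (K * (e / K))"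
          using elim x K(1) by (intro mult_left_mono) (auto simp: dist_norm less_imp_le)
        finally show "norm ((\<Sum>i<Suc n. h *\<^sub>R (case i of 0 \<Rightarrow> 0 | Suc m \<Rightarrow> ?L (?D m z x))) - h *\<^sub>R ?L (V z x)) \<le> e * norm h"
          using K(1) by (simp add: mult.commute)
      qed
    qed
    then show "\<forall>\<^sub>F n in sequentially. \<forall>x\<in>{0..T}. \<forall>h. norm ((\<Sum>i<n. h *\<^sub>R (case i of 0 \<Rightarrow> 0 | Suc m \<Rightarrow> pencil_apply (P x) (Q x) z (?D m z x)))
        - h *\<^sub>R pencil_apply (P x) (Q x) z (V z x)) \<le> e * norm h"
      by (subst (asm) eventually_sequentially_Suc)
  next
    show "0 \<in> {0..T}" using T by simp
    have "?D k z 0 = 0" if "k \<notin> {0}" for k using that by (cases k) auto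
    then show "(\<lambda>k. ?D k z 0) sums u0" using sums_finite[of "{0}" "\<lambda>k. ?D k z 0"] by simp
  qed auto
  then obtain g where g: "\<And>x. x \<in> {0..T} \<Longrightarrow> (\<lambda>k. ?D k z x) sums g x"
    "\<And>x. x \<in> {0..T} \<Longrightarrow> (g has_derivative (\<lambda>h. h *\<^sub>R pencil_apply (P x) (Q x) z (V z x))) (at x within {0..T})"
    by blast
  have "V z x = g x" if "x \<in> {0..T}" for x using g(1)[OF that] unfolding V_def by (rule sums_unique[symmetric])
  then show "(V z has_vector_derivative pencil_apply (P t) (Q t) z (V z t)) (at t within {0..T})"
    unfolding has_vector_derivative_def by (rule has_derivative_transform[OF t _ g(2)[OF t]])
qed

end

section \<open>Energy estimates for the Fourier modes\<close>

text \<open>Gronwall's argument: \<open>exp (- 2 * \<mu> * t) * (norm (v t))^2\<close> is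
  nonincreasing. The hypothesis concerns the open interval only, which matches the supremum over
  \<open>0 < t < T\<close> in \<open>lam_max_plus\<close>.\<close>

lemma energy_estimate:
  fixes v :: "real \<Rightarrow> 'a::real_inner"
  assumes T: "T > 0"
    and v: "\<And>t. t \<in> {0..T} \<Longrightarrow> (v has_vector_derivative F t) (at t within {0..T})"
    and F: "\<And>t. 0 < t \<Longrightarrow> t < T \<Longrightarrow> v t \<bullet> F t \<le> \<mu> * (norm (v t))\<^sup>2"
  shows "norm (v T) \<le> exp (\<mu> * T) * norm (v 0)"
proof -
  define h where "h = (\<lambda>t. exp (- 2 * \<mu> * t) * (norm (v t))\<^sup>2)"
  have der: "(h has_real_derivative exp (- 2 * \<mu> * t) * (2 * (v t \<bullet> F t) - 2 * \<mu> * (norm (v t))\<^sup>2)) (at t)"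
    if "0 < t" "t < T" for t
  proof -
    have "(v has_vector_derivative F t) (at t)" using v[of t] that by (simp add: at_within_Icc_at)
    then have vd: "(v has_derivative (\<lambda>h. h *\<^sub>R F t)) (at t)" by (simp add: has_vector_derivative_def)
    have "((\<lambda>t. v t \<bullet> v t) has_derivative (\<lambda>h. v t \<bullet> (h *\<^sub>R F t) + (h *\<^sub>R F t) \<bullet> v t)) (at t)"
      by (rule has_derivative_inner[OF vd vd])
    also have "(\<lambda>h. v t \<bullet> (h *\<^sub>R F t) + (h *\<^sub>R F t) \<bullet> v t) = (*) (2 * (v t \<bullet> F t))"
      by (auto simp: inner_commute algebra_simps)
    finally have "((\<lambda>t. v t \<bullet> v t) has_real_derivative 2 * (v t \<bullet> F t)) (at t)"
      by (simp add: has_field_derivative_def)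
    then show ?thesis unfolding h_def power2_norm_eq_inner
      by (auto intro!: derivative_eq_intros simp: algebra_simps)
  qed
  have "h T \<le> h 0"
  proof (rule DERIV_nonpos_imp_decreasing_open[OF less_imp_le[OF T]])
    show "\<exists>y. (h has_real_derivative y) (at t) \<and> y \<le> 0" if "0 < t" "t < T" for t
    proof -
      have "exp (- 2 * \<mu> * t) * (2 * (v t \<bullet> F t) - 2 * \<mu> * (norm (v t))\<^sup>2) \<le> 0"
        using F[OF that] by (intro mult_nonneg_nonpos) auto
      with der[OF that] show ?thesis by blast
    qed
    show "continuous_on {0..T} h"
      unfolding h_def using v
      by (intro continuous_intros) (meson continuous_on_eq_continuous_within has_vector_derivative_continuous)
  qed
  then have "(norm (v T))\<^sup>2 \<le> (norm (v 0))\<^sup>2 * exp (2 * (\<mu> * T))"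
    by (simp add: h_def exp_minus field_simps)
  also have "\<dots> = (exp (\<mu> * T) * norm (v 0))\<^sup>2"
    by (simp add: power_mult_distrib exp_double)
  finally show ?thesis by (rule power2_le_imp_le) simp
qed

section \<open>Hermitian matrices and their quadratic forms\<close>

lemma inner_matrix_vector_mult_adj: "x \<bullet> (H *v y) = (adj_mat H *v x) \<bullet> y"
  for H :: "complex^'n^'n"
proof -
  have c: "a \<bullet> (h * b) = (cnj h * a) \<bullet> b" for a b h :: complex
    by (simp add: inner_complex_def algebra_simps)
  have "x \<bullet> (H *v y) = (\<Sum>i\<in>UNIV. \<Sum>j\<in>UNIV. x $ i \<bullet> (H $ i $ j * y $ j))"
    by (simp add: inner_vec_def matrix_vector_mult_def inner_sum_right)
  also have "\<dots> = (\<Sum>j\<in>UNIV. \<Sum>i\<in>UNIV. (cnj (H $ i $ j) * x $ i) \<bullet> y $ j)"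
    by (subst sum.swap) (simp only: c)
  finally show ?thesis
    by (simp add: inner_vec_def matrix_vector_mult_def inner_sum_left adj_mat_def)
qed

lemma inner_imaginary_smult: "x \<bullet> (\<i> *s y) = - ((\<i> *s x) \<bullet> y)"
  for x y :: "complex^'n"
  unfolding inner_vec_def sum_negf[symmetric]
  by (rule sum.cong[OF refl]) (simp add: inner_complex_def)

lemma matrix_vector_mult_smult: "H *v (c *s x) = c *s (H *v x)"
  for H :: "complex^'n^'m"
  by (simp add: matrix_vector_mult_def vec_eq_iff sum_distrib_left mult_ac)

text \<open>The inner product here is the real part of the Hermitian one, and \<open>i H\<close> is
  skew for it: moving \<open>i\<close> and then \<open>H\<close> across shows that the number equals
  its own negative.\<close>

lemma inner_imaginary_hermitian:
  assumes "adj_mat H = H"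
  shows "v \<bullet> (\<i> *s (H *v v)) = 0"
proof -
  have "v \<bullet> (\<i> *s (H *v v)) = - ((\<i> *s v) \<bullet> (H *v v))" by (rule inner_imaginary_smult)
  also have "(\<i> *s v) \<bullet> (H *v v) = v \<bullet> (\<i> *s (H *v v))"
    using inner_matrix_vector_mult_adj[of "\<i> *s v" H v]
    by (simp add: assms matrix_vector_mult_smult inner_commute)
  finally show ?thesis by simp
qed

text \<open>By compactness the Rayleigh quotient attains its maximum on the unit sphere, and a
  maximizer is an eigenvector with the maximum as eigenvalue. A maximum that is not positive is
  covered by \<open>lam \<ge> 0\<close>.\<close>

lemma hermitian_quadratic_form_bound:
  fixes H :: "complex^'n^'n"
  assumes H: "adj_mat H = H" and lam: "lam \<ge> 0"
    and ev: "\<And>\<mu>. \<mu> > 0 \<Longrightarrow> of_real \<mu> \<in> eigenvalues H \<Longrightarrow> \<mu> \<le> lam"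
  shows "v \<bullet> (H *v v) \<le> lam * (norm v)\<^sup>2"
proof -
  have sym: "x \<bullet> (H *v y) = (H *v x) \<bullet> y" for x y
    using inner_matrix_vector_mult_adj[of x H y] H by simp
  have "continuous_on (sphere 0 1) (\<lambda>x. x \<bullet> (H *v x))"
    by (intro continuous_on_inner continuous_on_id continuous_on_matrix_vector_mult continuous_on_const)
  moreover obtain b :: "complex^'n" where "norm b = 1" using vector_choose_size[of 1] by auto
  ultimately obtain x where x: "norm x = 1" and max: "\<And>y. norm y = 1 \<Longrightarrow> y \<bullet> (H *v y) \<le> x \<bullet> (H *v x)"
    using continuous_attains_sup[of "sphere 0 1" "\<lambda>x. x \<bullet> (H *v x)"] by (metis compact_sphere dist_0_norm empty_iff mem_sphere)
  define \<mu> where "\<mu> = x \<bullet> (H *v x)"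
  have scale: "(c *\<^sub>R y) \<bullet> (H *v (c *\<^sub>R y)) = c\<^sup>2 * (y \<bullet> (H *v y))" for c y
    by (simp add: bounded_bilinear.scaleR_right[OF bounded_bilinear_matrix_vector_mult] power2_eq_square)
  have le: "y \<bullet> (H *v y) \<le> \<mu> * (norm y)\<^sup>2" for y
  proof (cases "y = 0")
    case False
    have "y \<bullet> (H *v y) = (norm y)\<^sup>2 * ((y /\<^sub>R norm y) \<bullet> (H *v (y /\<^sub>R norm y)))"
      unfolding scale using False by (simp add: mult.assoc[symmetric] flip: power_mult_distrib)
    also have "\<dots> \<le> (norm y)\<^sup>2 * \<mu>"
      unfolding \<mu>_def using False by (intro mult_left_mono max) auto
    finally show ?thesis by (simp add: mult.commute)
  qed (simp add: inner_vec_def)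
  \<comment> \<open>the form \<open>\<mu> |y|\<^sup>2 - \<langle>y, H y\<rangle>\<close> is nonnegative and vanishes at \<open>x\<close>, so its gradient \<open>2 w\<close> there is zero\<close>
  define w where "w = \<mu> *\<^sub>R x - H *v x"
  have "w = 0"
  proof -
    have quad: "0 \<le> 2 * s * (norm w)\<^sup>2 + s\<^sup>2 * (\<mu> * (norm w)\<^sup>2 - w \<bullet> (H *v w))" for s
    proof -
      let ?y = "x + s *\<^sub>R w"
      have 1: "(norm ?y)\<^sup>2 = 1 + 2 * s * (x \<bullet> w) + s\<^sup>2 * (norm w)\<^sup>2"
        unfolding power2_norm_eq_inner using x
        by (simp add: norm_eq_1 inner_add_left inner_add_right inner_commute[of w x] power2_eq_square algebra_simps)
      have 2: "?y \<bullet> (H *v ?y) = \<mu> + 2 * s * ((H *v x) \<bullet> w) + s\<^sup>2 * (w \<bullet> (H *v w))"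
        by (simp add: matrix_vector_right_distrib bounded_bilinear.scaleR_right[OF bounded_bilinear_matrix_vector_mult]
            inner_add_left inner_add_right sym[of x w] inner_commute[of w "H *v x"] \<mu>_def power2_eq_square algebra_simps)
      have 3: "(norm w)\<^sup>2 = \<mu> * (x \<bullet> w) - (H *v x) \<bullet> w"
        by (simp add: w_def power2_norm_eq_inner inner_diff_left)
      have "0 \<le> \<mu> * (norm ?y)\<^sup>2 - ?y \<bullet> (H *v ?y)" using le[of ?y] by simp
      also have "\<dots> = 2 * s * (\<mu> * (x \<bullet> w) - (H *v x) \<bullet> w) + s\<^sup>2 * (\<mu> * (norm w)\<^sup>2 - w \<bullet> (H *v w))"
        unfolding 1 2 by (simp add: algebra_simps)
      finally show ?thesis unfolding 3[symmetric] .
    qed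
    define q where "q = \<mu> * (norm w)\<^sup>2 - w \<bullet> (H *v w)"
    have q: "q \<ge> 0" using le[of w] by (simp add: q_def)
    define n where "n = (norm w)\<^sup>2"
    \<comment> \<open>A negative step proportional to \<open>n\<close> makes the linear term
      outweigh the quadratic one; \<open>q + 1\<close> in the denominator keeps the step defined
      when \<open>q = 0\<close>.\<close>
    have "0 \<le> 2 * (- n / (q + 1)) * n + (- n / (q + 1))\<^sup>2 * q"
      using quad[of "- n / (q + 1)"] by (simp only: q_def n_def)
    also have "\<dots> = - (n\<^sup>2 * ((q + 2) / (q + 1)\<^sup>2))"
      using q by (simp add: divide_simps power2_eq_square) (simp add: algebra_simps)
    finally have "n\<^sup>2 * ((q + 2) / (q + 1)\<^sup>2) \<le> 0" by simp
    moreover have "(q + 2) / (q + 1)\<^sup>2 > 0" using q by simp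
    ultimately have "n = 0"
      by (metis linorder_not_less mult_pos_pos zero_less_power2)
    then have "(norm w)\<^sup>2 = 0" by (simp add: n_def)
    then show ?thesis by simp
  qed
  then have Hx: "H *v x = of_real \<mu> *s x"
    by (simp add: w_def vec_eq_iff scaleR_conv_of_real[where 'a = complex])
  have "\<mu> \<le> lam"
  proof (cases "\<mu> > 0")
    case True
    have "of_real \<mu> \<in> eigenvalues H"
      unfolding eigenvalues_def using Hx x by (auto intro!: exI[of _ x])
    with ev True show ?thesis by blast
  qed (use lam in simp)
  then have "\<mu> * (norm v)\<^sup>2 \<le> lam * (norm v)\<^sup>2" by (intro mult_right_mono) auto
  with le[of v] show ?thesis by linarith
qed

lemma hermitian_H1: "adj_mat (H1 A t) = H1 A t"
  by (simp add: adj_mat_def H1_def vec_eq_iff add.commute)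

lemma hermitian_H2: "adj_mat (H2 A t) = H2 A t"
  by (simp add: adj_mat_def H2_def vec_eq_iff divide_simps algebra_simps)

lemma continuous_on_H1: "continuous_on S A \<Longrightarrow> continuous_on S (H1 A)"
  unfolding H1_def[abs_def] adj_mat_def by (auto intro!: continuous_intros)

lemma continuous_on_H2: "continuous_on S A \<Longrightarrow> continuous_on S (H2 A)"
  unfolding H2_def[abs_def] adj_mat_def by (auto intro!: continuous_intros)

section \<open>The Fourier mode equation at a complex frequency\<close>

definition imag_mat :: "complex^'n^'n \<Rightarrow> complex^'n^'n" where
  "imag_mat M = (\<chi> a b. \<i> * M $ a $ b)"

lemma imag_mat_mult: "imag_mat M *v x = \<i> *s (M *v x)"
  by (simp add: imag_mat_def matrix_vector_mult_def vec_eq_iff sum_distrib_left mult_ac)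

lemma continuous_on_imag_mat: "continuous_on S M \<Longrightarrow> continuous_on S (\<lambda>t. imag_mat (M t))"
  unfolding imag_mat_def by (auto intro!: continuous_intros)

text \<open>The frequency \<open>z\<close> is complex on purpose: real values give the blocks of the
  semidiscrete system, and \<open>z = -i\<close> gives back the original equation.\<close>

definition fourier_rhs :: "(real \<Rightarrow> complex^'n^'n) \<Rightarrow> complex \<Rightarrow> real \<Rightarrow> complex^'n \<Rightarrow> complex^'n" where
  "fourier_rhs A z t v = \<i> *s (z *s (H1 A t *v v) + H2 A t *v v)"

lemma fourier_rhs_pencil: "fourier_rhs A z t v = pencil_apply (imag_mat (H2 A t)) (imag_mat (H1 A t)) z v"
  by (simp add: fourier_rhs_def pencil_apply_def imag_mat_mult vector_add_ldistrib vector_smult_assoc mult.commute)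

lemma fourier_rhs_diff: "fourier_rhs A z t (v - w) = fourier_rhs A z t v - fourier_rhs A z t w"
  by (simp add: fourier_rhs_pencil pencil_apply_diff)

lemma fourier_rhs_minus_i: "fourier_rhs A (- \<i>) t v = A t *v v"
proof -
  have "fourier_rhs A (- \<i>) t v = (H1 A t + imag_mat (H2 A t)) *v v"
    by (simp add: fourier_rhs_def vector_add_ldistrib vector_smult_assoc imag_mat_mult matrix_vector_mult_add_rdistrib)
  also have "H1 A t + imag_mat (H2 A t) = A t"
    by (simp add: vec_eq_iff H1_def H2_def imag_mat_def) (simp add: divide_simps)
  finally show ?thesis .
qed

text \<open>The parts \<open>i * Re z * H1\<close> and \<open>i * H2\<close> are skew and drop out
  of the energy balance; only the part of \<open>i * z * H1\<close> that comes from
  \<open>Im z\<close> remains.\<close>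

lemma inner_fourier_rhs: "v \<bullet> fourier_rhs A z t v = - Im z * (v \<bullet> (H1 A t *v v))"
proof -
  have z: "\<i> * z = of_real (Re z) * \<i> + of_real (- Im z)" by (simp add: complex_eq_iff)
  have r: "complex_of_real c *s x = c *\<^sub>R x" for c and x :: "complex^'n"
    by (simp add: vec_eq_iff scaleR_conv_of_real[where 'a = complex])
  have "fourier_rhs A z t v = (\<i> * z) *s (H1 A t *v v) + \<i> *s (H2 A t *v v)"
    by (simp add: fourier_rhs_def vector_add_ldistrib vector_smult_assoc)
  also have "\<dots> = Re z *\<^sub>R (\<i> *s (H1 A t *v v)) + (- Im z) *\<^sub>R (H1 A t *v v) + \<i> *s (H2 A t *v v)"
    unfolding z vector_sadd_rdistrib r[symmetric] by (simp add: vector_smult_assoc)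
  finally show ?thesis
    by (simp add: inner_add_right inner_diff_right inner_imaginary_hermitian hermitian_H1 hermitian_H2)
qed

definition solves_fourier_mode ::
  "(real \<Rightarrow> complex^'n^'n) \<Rightarrow> real \<Rightarrow> complex \<Rightarrow> complex^'n \<Rightarrow> (real \<Rightarrow> complex^'n) \<Rightarrow> bool" where
  "solves_fourier_mode A T z u0 v \<longleftrightarrow>
     v 0 = u0 \<and> (\<forall>t\<in>{0..T}. (v has_vector_derivative fourier_rhs A z t (v t)) (at t within {0..T}))"

text \<open>A crude bound valid for both signs of \<open>Im z\<close>. It controls the modes near
  the real line, where the quadrature error is estimated, and with zero initial data it gives
  uniqueness.\<close>

lemma fourier_mode_strip_bound:
  assumes T: "T > 0" and v: "solves_fourier_mode A T z u0 v"
    and L: "\<And>t. t \<in> {0..T} \<Longrightarrow> norm (H1 A t) \<le> \<Lambda>"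
  shows "norm (v T) \<le> exp (\<bar>Im z\<bar> * \<Lambda> * T) * norm u0"
proof -
  have v0: "v 0 = u0" using v by (simp add: solves_fourier_mode_def)
  have "norm (v T) \<le> exp (\<bar>Im z\<bar> * \<Lambda> * T) * norm (v 0)"
  proof (rule energy_estimate[OF T])
    show "(v has_vector_derivative fourier_rhs A z t (v t)) (at t within {0..T})" if "t \<in> {0..T}" for t
      using v that by (simp add: solves_fourier_mode_def)
    show "v t \<bullet> fourier_rhs A z t (v t) \<le> \<bar>Im z\<bar> * \<Lambda> * (norm (v t))\<^sup>2" if "0 < t" "t < T" for t
    proof -
      have "\<bar>v t \<bullet> (H1 A t *v v t)\<bar> \<le> norm (v t) * (norm (H1 A t) * norm (v t))"
        using Cauchy_Schwarz_ineq2 norm_matrix_vector_mult_le by (meson mult_left_mono norm_ge_zero order_trans)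
      also have "\<dots> \<le> norm (v t) * (\<Lambda> * norm (v t))"
        using L[of t] that by (intro mult_left_mono mult_right_mono) auto
      finally have "\<bar>v t \<bullet> (H1 A t *v v t)\<bar> \<le> \<Lambda> * (norm (v t))\<^sup>2" by (simp add: power2_eq_square mult_ac)
      then have "\<bar>Im z\<bar> * \<bar>v t \<bullet> (H1 A t *v v t)\<bar> \<le> \<bar>Im z\<bar> * (\<Lambda> * (norm (v t))\<^sup>2)"
        by (intro mult_left_mono) auto
      moreover have "- Im z * (v t \<bullet> (H1 A t *v v t)) \<le> \<bar>Im z\<bar> * \<bar>v t \<bullet> (H1 A t *v v t)\<bar>"
        unfolding abs_mult[symmetric] by (simp add: abs_le_iff)
      ultimately show ?thesis by (simp add: inner_fourier_rhs mult.assoc)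
    qed
  qed
  then show ?thesis by (simp add: v0)
qed

text \<open>Eigenvalues are bounded by the matrix norm. This gives meaning to the \<open>Sup\<close>
  in \<open>lam_max_plus\<close>, which is unspecified for unbounded sets.\<close>

lemma bdd_above_positive_eigenvalues:
  fixes H :: "real \<Rightarrow> complex^'n^'n"
  assumes L: "\<And>t. t \<in> {0..T} \<Longrightarrow> norm (H t) \<le> \<Lambda>"
  shows "bdd_above (insert 0 {norm l | t l. 0 < t \<and> t < T \<and> l \<in> eigenvalues (H t) \<and> l \<in> \<real> \<and> 0 < Re l})"
proof -
  have "norm l \<le> \<Lambda>" if l: "0 < t" "t < T" "l \<in> eigenvalues (H t)" for t l
  proof -
    obtain x where x: "x \<noteq> 0" "H t *v x = l *s x" using l by (auto simp: eigenvalues_def)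
    have "norm l * norm x \<le> norm (H t) * norm x"
      using norm_matrix_vector_mult_le[of "H t" x] x by (simp add: norm_vector_smult)
    then have "norm l \<le> norm (H t)" using x by simp
    also have "\<dots> \<le> \<Lambda>" by (rule L) (use l in simp)
    finally show ?thesis .
  qed
  then show ?thesis by (intro bdd_aboveI[of _ "max 0 \<Lambda>"]) (auto simp: le_max_iff_disj)
qed

lemma lam_max_plus_nonneg:
  fixes H :: "real \<Rightarrow> complex^'n^'n"
  assumes L: "\<And>t. t \<in> {0..T} \<Longrightarrow> norm (H t) \<le> \<Lambda>"
  shows "lam_max_plus H T \<ge> 0"
  unfolding lam_max_plus_def by (rule cSup_upper[OF _ bdd_above_positive_eigenvalues[OF L]]) auto

text \<open>In the lower half plane \<open>- Im z \<ge> 0\<close>, so an upper bound of the form of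
  \<open>H1\<close> suffices and the rate is \<open>lam_max_plus\<close> instead of a norm. For
  \<open>p \<ge> lam_max_plus (H1 A) T * T\<close> this growth is cancelled by the factor
  \<open>exp (- i z p)\<close>.\<close>

lemma fourier_mode_lower_bound:
  assumes T: "T > 0" and v: "solves_fourier_mode A T z u0 v"
    and L: "\<And>t. t \<in> {0..T} \<Longrightarrow> norm (H1 A t) \<le> \<Lambda>" and z: "Im z \<le> 0"
  shows "norm (v T) \<le> exp (- Im z * lam_max_plus (H1 A) T * T) * norm u0"
proof -
  let ?l = "lam_max_plus (H1 A) T"
  have v0: "v 0 = u0" using v by (simp add: solves_fourier_mode_def)
  have "norm (v T) \<le> exp (- Im z * ?l * T) * norm (v 0)"
  proof (rule energy_estimate[OF T])
    show "(v has_vector_derivative fourier_rhs A z t (v t)) (at t within {0..T})" if "t \<in> {0..T}" for t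
      using v that by (simp add: solves_fourier_mode_def)
    show "v t \<bullet> fourier_rhs A z t (v t) \<le> - Im z * ?l * (norm (v t))\<^sup>2" if t: "0 < t" "t < T" for t
    proof -
      have "v t \<bullet> (H1 A t *v v t) \<le> ?l * (norm (v t))\<^sup>2"
      proof (rule hermitian_quadratic_form_bound[OF hermitian_H1 lam_max_plus_nonneg[OF L]])
        show "\<mu> \<le> ?l" if "\<mu> > 0" "of_real \<mu> \<in> eigenvalues (H1 A t)" for \<mu>
          unfolding lam_max_plus_def
        proof (rule cSup_upper[OF _ bdd_above_positive_eigenvalues[OF L]], rule insertI2, rule CollectI)
          show "\<exists>t l. \<mu> = norm l \<and> 0 < t \<and> t < T \<and> l \<in> eigenvalues (H1 A t) \<and> l \<in> \<real> \<and> 0 < Re l"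
            using that t by (intro exI[of _ t] exI[of _ "complex_of_real \<mu>"]) auto
        qed
      qed
      then have "- Im z * (v t \<bullet> (H1 A t *v v t)) \<le> - Im z * (?l * (norm (v t))\<^sup>2)"
        using z by (intro mult_left_mono) auto
      then show ?thesis by (simp only: inner_fourier_rhs mult.assoc)
    qed
  qed
  then show ?thesis by (simp add: v0)
qed

lemma fourier_mode_unique:
  assumes T: "T > 0" and v: "solves_fourier_mode A T z u0 v" and w: "solves_fourier_mode A T z u0 w"
    and L: "\<And>t. t \<in> {0..T} \<Longrightarrow> norm (H1 A t) \<le> \<Lambda>"
  shows "v T = w T"
proof -
  have "solves_fourier_mode A T z 0 (\<lambda>t. v t - w t)"
    using v w by (auto simp: solves_fourier_mode_def fourier_rhs_diff intro: has_vector_derivative_diff)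
  from fourier_mode_strip_bound[OF T this L] show ?thesis by simp
qed

lemma fourier_mode_holomorphic:
  fixes A :: "real \<Rightarrow> complex^'n^'n"
  assumes T: "T > 0" and A: "continuous_on {0..T} A"
  obtains V where "\<And>z. solves_fourier_mode A T z u0 (V z)"
    "\<And>a. (\<lambda>z. V z T $ a) holomorphic_on UNIV"
proof (rule linear_ode_holomorphic_solution[OF T continuous_on_imag_mat[OF continuous_on_H2[OF A]]
      continuous_on_imag_mat[OF continuous_on_H1[OF A]], of u0])
  fix V
  assume "\<And>z. V z 0 = u0"
    and "\<And>z t. t \<in> {0..T} \<Longrightarrow> (V z has_vector_derivative
      pencil_apply (imag_mat (H2 A t)) (imag_mat (H1 A t)) z (V z t)) (at t within {0..T})"
    and "\<And>t a. t \<in> {0..T} \<Longrightarrow> (\<lambda>z. V z t $ a) holomorphic_on UNIV"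
  then show thesis
    using T by (intro that[of V]) (simp_all add: solves_fourier_mode_def fourier_rhs_pencil)
qed

text \<open>Both left Kronecker factors, \<open>D_xi\<close> and the identity, are diagonal, so the
  system decouples into one mode equation per node.\<close>

lemma block_solves_fourier_mode:
  fixes A :: "real \<Rightarrow> complex^'n^'n"
  assumes w: "solves_semidiscrete A T X N u0 w" and j: "j \<le> N"
  shows "solves_fourier_mode A T (of_real (xi X N j)) (xi_vec X N j *s u0) (\<lambda>t. block (w t) j)"
proof -
  have sums: "(\<Sum>s\<in>{0..N} \<times> UNIV. semidiscrete_mat A X N t (j, a) s * w t s) =
      fourier_rhs A (of_real (xi X N j)) t (block (w t) j) $ a" for t a
  proof -
    let ?z = "of_real (xi X N j) :: complex"
    have "(\<Sum>s\<in>{0..N} \<times> UNIV. semidiscrete_mat A X N t (j, a) s * w t s) =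
        (\<Sum>k\<in>{0..N}. \<Sum>b\<in>UNIV. semidiscrete_mat A X N t (j, a) (k, b) * w t (k, b))"
      by (simp add: sum.cartesian_product)
    also have "\<dots> = (\<Sum>k\<in>{0..N}. if j = k then \<Sum>b\<in>UNIV. \<i> * (?z * H1 A t $ a $ b + H2 A t $ a $ b) * w t (j, b) else 0)"
      by (intro sum.cong refl) (auto simp: semidiscrete_mat_def kron_def D_xi_def id_mat_def)
    also have "\<dots> = (\<Sum>b\<in>UNIV. \<i> * (?z * H1 A t $ a $ b + H2 A t $ a $ b) * w t (j, b))"
      using j by simp
    also have "\<dots> = fourier_rhs A ?z t (block (w t) j) $ a"
      by (simp add: fourier_rhs_def block_def matrix_vector_mult_def sum_distrib_left algebra_simps sum.distrib)
    finally show ?thesis .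
  qed
  have comp: "((\<lambda>t. w t (j, a)) has_vector_derivative fourier_rhs A (of_real (xi X N j)) t (block (w t) j) $ a) (at t within {0..T})"
    if "t \<in> {0..T}" for t a
  proof -
    have "(j, a) \<in> {0..N} \<times> UNIV" using j by simp
    with w that have "((\<lambda>t. w t (j, a)) has_vector_derivative
        (\<Sum>s\<in>{0..N} \<times> UNIV. semidiscrete_mat A X N t (j, a) s * w t s)) (at t within {0..T})"
      unfolding solves_semidiscrete_def by blast
    then show ?thesis by (simp only: sums)
  qed
  have "((\<lambda>t. block (w t) j) has_vector_derivative fourier_rhs A (of_real (xi X N j)) t (block (w t) j)) (at t within {0..T})"
    if "t \<in> {0..T}" for t
    unfolding has_vector_derivative_def
  \<comment> \<open>Real basis vectors of \<open>complex^'n\<close> are \<open>axis a b\<close> with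
    \<open>b\<close> a real basis vector of the complex numbers, so the scalar derivatives
    \<open>comp\<close> suffice.\<close>
  proof (subst has_derivative_componentwise_within, intro ballI)
    fix i :: "complex^'n" assume "i \<in> Basis"
    then obtain a b where i: "i = axis a b" "b \<in> Basis" by (auto simp: Basis_vec_def)
    show "((\<lambda>t. block (w t) j \<bullet> i) has_derivative (\<lambda>h. (h *\<^sub>R fourier_rhs A (of_real (xi X N j)) t (block (w t) j)) \<bullet> i)) (at t within {0..T})"
      using has_derivative_inner_left[OF comp[OF that, of a, unfolded has_vector_derivative_def], of b]
      by (simp add: i inner_axis block_def)
  qed
  moreover have "block (w 0) j = xi_vec X N j *s u0"
    using w j by (simp add: solves_semidiscrete_def block_def vec_eq_iff kron_vec_def)
  ultimately show ?thesis by (simp add: solves_fourier_mode_def)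
qed

section \<open>Error of the recovered solution\<close>

lemma fourier_mode_smult:
  assumes "solves_fourier_mode A T z u0 v"
  shows "solves_fourier_mode A T z (c *s u0) (\<lambda>t. c *s v t)"
proof -
  have "fourier_rhs A z t (c *s x) = c *s fourier_rhs A z t x" for t x
    by (simp add: fourier_rhs_def matrix_vector_mult_smult vector_add_ldistrib vector_smult_assoc mult_ac)
  then show ?thesis using assms
    by (auto simp: solves_fourier_mode_def intro: bounded_linear.has_vector_derivative[OF bounded_linear_vector_smult])
qed

lemma w_hc_component:
  fixes V :: "complex \<Rightarrow> complex^'n"
  assumes block: "\<And>j. j \<le> N \<Longrightarrow> block (w t) j = xi_vec X N j *s V (of_real (xi X N j))"
  shows "w_hc X N w t p $ a =
    trapezoid_sum X N (\<lambda>x. V (of_real x) $ a * exp (- \<i> * of_real (x * p)) / of_real (pi * (1 + x\<^sup>2)))"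
    (is "_ = trapezoid_sum X N ?f")
proof -
  have node: "(exp (- \<i> * of_real (xi X N j * p)) *s block (w t) j) $ a = ?f (xi X N j)" if "j \<le> N" for j
    by (simp add: block[OF that] xi_vec_def)
  have "(\<Sum>j = 1..N - 1. (exp (- \<i> * of_real (xi X N j * p)) *s block (w t) j) $ a) = (\<Sum>j = 1..N - 1. ?f (xi X N j))"
    by (intro sum.cong refl node) auto
  then show ?thesis
    unfolding w_hc_def trapezoid_sum_def
    by (simp only: vector_add_component vector_scaleR_component sum_component node[OF order_refl] node[OF le0])
qed

text \<open>The quadrature bound is applied to each component of the holomorphic mode family, with
  \<open>G = norm u0\<close> and \<open>L = exp (\<Lambda> * T)\<close>. Summing over components
  gives \<open>CARD('n)\<close>, and undoing the weight \<open>exp (- p)\<close> gives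
  \<open>exp p\<close>.\<close>

lemma pointwise_error_bound:
  fixes A :: "real \<Rightarrow> complex^'n^'n"
  assumes T: "T > 0" and A: "continuous_on {0..T} A"
    and L: "\<And>t. t \<in> {0..T} \<Longrightarrow> norm (H1 A t) \<le> \<Lambda>"
    and X: "X > 0" and N: "N > 0" and p: "p \<ge> lam_max_plus (H1 A) T * T"
    and u: "solves_linear_ode A T u0 u" and w: "solves_semidiscrete A T X N u0 w"
  shows "norm (u_hc X N w T p - u T)
    \<le> 16 * real CARD('n) * exp (\<Lambda> * T) * exp p * (mesh X N * (1 + p) + 1 / X) * norm u0"
proof -
  have \<Lambda>: "\<Lambda> \<ge> 0" using order_trans[OF norm_ge_zero L[of 0]] T by simp
  have p0: "p \<ge> 0" using p T lam_max_plus_nonneg[OF L] by (meson less_imp_le mult_nonneg_nonneg order_trans)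
  obtain V where V: "\<And>z. solves_fourier_mode A T z u0 (V z)"
    and hol: "\<And>a. (\<lambda>z. V z T $ a) holomorphic_on UNIV"
    using fourier_mode_holomorphic[OF T A, of u0] by blast
  define e where "e = w_hc X N w T p - exp (- p) *\<^sub>R u T"
  have "solves_fourier_mode A T (- \<i>) u0 u"
    using u by (simp add: solves_fourier_mode_def solves_linear_ode_def fourier_rhs_minus_i)
  from fourier_mode_unique[OF T this V L] have uT: "u T = V (- \<i>) T" by simp
  have blk: "block (w T) j = xi_vec X N j *s V (of_real (xi X N j)) T" if "j \<le> N" for j
    using fourier_mode_unique[OF T block_solves_fourier_mode[OF w that] fourier_mode_smult[OF V] L] by simp
  have "norm (e $ a) \<le> 16 * norm u0 * exp (\<Lambda> * T) * (mesh X N * (1 + p) + 1 / X)" for a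
  proof -
    have "norm (trapezoid_sum X N (\<lambda>x. V (of_real x) T $ a * exp (- \<i> * of_real (x * p)) / of_real (pi * (1 + x\<^sup>2)))
        - of_real (exp (- p)) * V (- \<i>) T $ a) \<le> 16 * norm u0 * exp (\<Lambda> * T) * (mesh X N * (1 + p) + 1 / X)"
    proof (rule laplace_quadrature_bound[OF hol p0 _ _ _ X N])
      show "1 \<le> exp (\<Lambda> * T)" using \<Lambda> T by simp
      show "norm (V z T $ a) \<le> norm u0 * exp (p * - Im z)" if z: "Im z \<le> 0" for z
      proof -
        have "norm (V z T $ a) \<le> norm (V z T)" by (rule Finite_Cartesian_Product.norm_nth_le)
        also have "\<dots> \<le> exp (- Im z * lam_max_plus (H1 A) T * T) * norm u0"
          by (rule fourier_mode_lower_bound[OF T V L z])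
        also have "- Im z * lam_max_plus (H1 A) T * T \<le> - Im z * p"
          unfolding mult.assoc using p z by (intro mult_left_mono) auto
        finally show ?thesis by (simp add: mult.commute mult_left_mono)
      qed
      show "norm (V z T $ a) \<le> norm u0 * exp (\<Lambda> * T)" if z: "\<bar>Im z\<bar> \<le> 1" for z
      proof -
        have "norm (V z T $ a) \<le> norm (V z T)" by (rule Finite_Cartesian_Product.norm_nth_le)
        also have "\<dots> \<le> exp (\<bar>Im z\<bar> * \<Lambda> * T) * norm u0"
          by (rule fourier_mode_strip_bound[OF T V L])
        also have "\<dots> \<le> exp (\<Lambda> * T) * norm u0"
          using mult_right_mono[OF z, of "\<Lambda> * T"] \<Lambda> T by (intro mult_right_mono) (auto simp: mult.assoc)
        finally show ?thesis by (simp add: mult.commute)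
      qed
    qed
    moreover have "e $ a = w_hc X N w T p $ a - of_real (exp (- p)) * V (- \<i>) T $ a"
      unfolding e_def uT by (simp add: scaleR_conv_of_real[where 'a = complex])
    ultimately show ?thesis
      by (simp only: w_hc_component[where V = "\<lambda>z. V z T" and N = N and X = X and w = w and t = T, OF blk])
  qed
  then have "norm e \<le> (\<Sum>a\<in>(UNIV :: 'n set). 16 * norm u0 * exp (\<Lambda> * T) * (mesh X N * (1 + p) + 1 / X))"
    unfolding norm_vec_def by (intro order_trans[OF L2_set_le_sum] sum_mono) auto
  moreover have "u_hc X N w T p - u T = exp p *\<^sub>R e"
    by (simp add: u_hc_def e_def scaleR_right_diff_distrib flip: exp_add)
  ultimately show ?thesis
    by (simp add: mult_left_mono[of _ _ "exp p"] mult_ac)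
qed

section \<open>From pointwise to L2 bounds, and the final constants\<close>

lemma L2_norm_on_Ioo_le:
  assumes B: "\<And>p. a < p \<Longrightarrow> p < a + R \<Longrightarrow> norm (f p) \<le> B" and "B \<ge> 0" "R \<ge> 1"
  shows "L2_norm_on {a<..<a + R} f \<le> B * R"
proof -
  have "(LINT p:{a<..<a + R}|lborel. (norm (f p))\<^sup>2) \<le> (LINT p|lborel. indicator {a<..<a + R} p * B\<^sup>2)"
    unfolding set_lebesgue_integral_def
  \<comment> \<open>A nonintegrable integrand has integral 0 by default; the nonnegative majorant
    covers that case too.\<close>
  proof (rule integral_mono')
    show "indicator {a<..<a + R} p *\<^sub>R (norm (f p))\<^sup>2 \<le> indicator {a<..<a + R} p * B\<^sup>2" for p
      using power_mono[OF B[of p], of 2] by (auto simp: indicator_def)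
  qed (use assms in auto)
  also have "\<dots> = R * B\<^sup>2" using assms by simp
  also have "\<dots> \<le> (B * R)\<^sup>2"
    using mult_right_mono[of R "R * R" "B\<^sup>2"] assms by (simp add: power2_eq_square mult_ac)
  finally show ?thesis unfolding L2_norm_on_def using assms by (intro real_le_lsqrt) auto
qed

text \<open>The order of quantifiers is the point: \<open>K\<close> is chosen from \<open>A\<close>
  and \<open>T\<close> alone, before the truncation, the recovery domain, the mesh and the initial
  value.\<close>

lemma recovery_error_bound:
  fixes A :: "real \<Rightarrow> complex^'n^'n"
  assumes T: "T > 0" and A: "continuous_on {0..T} A"
  obtains K where "K > 0"
    "\<And>X pd (R :: real) N u0 u w. X > 0 \<Longrightarrow> pd \<ge> lam_max_plus (H1 A) T * T \<Longrightarrow> R \<ge> 1 \<Longrightarrow> N > 0 \<Longrightarrow>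
       solves_linear_ode A T u0 u \<Longrightarrow> solves_semidiscrete A T X N u0 w \<Longrightarrow>
       pd \<ge> 0 \<and> L2_norm_on {pd<..<pd + R} (\<lambda>p. u_hc X N w T p - u T)
         \<le> K * (R * exp R) * (mesh X N * (1 + pd + R) + 1 / X) * exp pd * norm u0"
proof -
  obtain \<Lambda> where L: "\<And>t. t \<in> {0..T} \<Longrightarrow> norm (H1 A t) \<le> \<Lambda>"
    using continuous_on_Icc_norm_bound[OF continuous_on_H1[OF A]] by blast
  define K where "K = 16 * real CARD('n) * exp (\<Lambda> * T)"
  have K: "K > 0" by (simp add: K_def)
  show ?thesis
  proof (rule that[OF K], rule conjI)
    fix X pd R :: real and N u0 u w
    assume X: "X > 0" and pd: "pd \<ge> lam_max_plus (H1 A) T * T" and R: "R \<ge> 1" and N: "N > 0"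
      and u: "solves_linear_ode A T u0 u" and w: "solves_semidiscrete A T X N u0 w"
    show pd0: "pd \<ge> 0"
      using pd T lam_max_plus_nonneg[OF L] by (meson less_imp_le mult_nonneg_nonneg order_trans)
    have m: "mesh X N \<ge> 0" using X by (simp add: mesh_def)
    have "L2_norm_on {pd<..<pd + R} (\<lambda>p. u_hc X N w T p - u T)
        \<le> K * exp (pd + R) * (mesh X N * (1 + pd + R) + 1 / X) * norm u0 * R"
    proof (rule L2_norm_on_Ioo_le[OF _ _ R])
      fix p assume p: "pd < p" "p < pd + R"
      then have "norm (u_hc X N w T p - u T) \<le> K * exp p * (mesh X N * (1 + p) + 1 / X) * norm u0"
        unfolding K_def using pd by (intro pointwise_error_bound[OF T A L X N _ u w]) auto
      also have "\<dots> \<le> K * exp (pd + R) * (mesh X N * (1 + pd + R) + 1 / X) * norm u0"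
        using p pd0 K X m by (intro mult_right_mono mult_mono add_right_mono mult_left_mono add_nonneg_nonneg) auto
      finally show "norm (u_hc X N w T p - u T) \<le> K * exp (pd + R) * (mesh X N * (1 + pd + R) + 1 / X) * norm u0" .
    qed (use K m pd0 R X in \<open>auto intro!: mult_nonneg_nonneg add_nonneg_nonneg\<close>)
    then show "L2_norm_on {pd<..<pd + R} (\<lambda>p. u_hc X N w T p - u T)
         \<le> K * (R * exp R) * (mesh X N * (1 + pd + R) + 1 / X) * exp pd * norm u0"
      by (simp add: exp_add mult_ac)
  qed
qed

text \<open>With \<open>y = h * sqrt (s^2 + D)\<close> one has
  \<open>y \<le> \<epsilon> + y^2 / \<epsilon>\<close>, by cases on
  \<open>y \<le> \<epsilon>\<close>. The lower bound \<open>\<delta>\<close> allows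
  \<open>1 + s + R\<close> to be absorbed into a multiple of \<open>sqrt (s^2 + D)\<close>.\<close>

lemma first_order_le_second_order:
  fixes h s \<epsilon> \<delta> R D c :: real
  assumes \<epsilon>: "\<epsilon> > 0" and \<delta>: "0 < \<delta>" "\<delta> \<le> s\<^sup>2 + D" and "h \<ge> 0" "0 \<le> R" "R \<le> c" "0 \<le> s" "0 \<le> D"
  shows "h * (1 + s + R) \<le> sqrt (2 * (1 + c)\<^sup>2 / \<delta> + 2) * (\<epsilon> + 1 / \<epsilon> * h\<^sup>2 * (s\<^sup>2 + D))"
proof -
  define \<kappa> where "\<kappa> = sqrt (2 * (1 + c)\<^sup>2 / \<delta> + 2)"
  have \<kappa>: "\<kappa> \<ge> 0" using \<delta> by (simp add: \<kappa>_def add_nonneg_nonneg)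
  define y where "y = h * sqrt (s\<^sup>2 + D)"
  have y0: "y \<ge> 0" using assms by (simp add: y_def)
  have y2: "y\<^sup>2 = h\<^sup>2 * (s\<^sup>2 + D)" using assms by (simp add: y_def power_mult_distrib)
  have "y \<le> \<epsilon> + y\<^sup>2 / \<epsilon>"
  proof (cases "y \<le> \<epsilon>")
    case False
    then have "y * \<epsilon> \<le> y * y" using y0 by (intro mult_left_mono) auto
    then have "y \<le> y\<^sup>2 / \<epsilon>" using \<epsilon> by (simp add: field_simps power2_eq_square)
    then show ?thesis using \<epsilon> by linarith
  qed (use \<epsilon> in \<open>simp add: add_increasing2\<close>)
  have "(1 + s + R)\<^sup>2 \<le> (1 + c + s)\<^sup>2" using assms by (intro power_mono) auto
  also have "\<dots> \<le> 2 * (1 + c)\<^sup>2 + 2 * s\<^sup>2"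
    using zero_le_power2[of "1 + c - s"] by (simp add: power2_eq_square algebra_simps)
  \<comment> \<open>The constant is written as a multiple of \<open>\<delta>\<close>, which is then
    replaced by the larger \<open>s^2 + D\<close>; this is the origin of the quotient by
    \<open>\<delta>\<close> in the factor.\<close>
  also have "2 * (1 + c)\<^sup>2 = 2 * (1 + c)\<^sup>2 / \<delta> * \<delta>" using \<delta> by simp
  also have "2 * (1 + c)\<^sup>2 / \<delta> * \<delta> + 2 * s\<^sup>2 \<le> 2 * (1 + c)\<^sup>2 / \<delta> * (s\<^sup>2 + D) + 2 * (s\<^sup>2 + D)"
    using assms by (intro add_mono mult_left_mono) auto
  finally have "(1 + s + R)\<^sup>2 \<le> (2 * (1 + c)\<^sup>2 / \<delta> + 2) * (s\<^sup>2 + D)" by (simp only: distrib_right)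
  then have "1 + s + R \<le> \<kappa> * sqrt (s\<^sup>2 + D)"
    unfolding \<kappa>_def real_sqrt_mult[symmetric] by (rule real_le_rsqrt)
  then have "h * (1 + s + R) \<le> h * (\<kappa> * sqrt (s\<^sup>2 + D))" using assms by (intro mult_left_mono) auto
  also have "\<dots> = \<kappa> * y" by (simp add: y_def)
  also have "\<dots> \<le> \<kappa> * (\<epsilon> + y\<^sup>2 / \<epsilon>)" using \<open>y \<le> \<epsilon> + y\<^sup>2 / \<epsilon>\<close> \<kappa> by (rule mult_left_mono)
  finally show ?thesis unfolding \<kappa>_def y2 by simp
qed

text \<open>The constants \<open>cX\<close> and \<open>cR\<close> spell out the O-conditions. The
  first clause has one \<open>C\<close> for all parameters, with \<open>\<delta>\<close> keeping the
  factor of the squared mesh size away from zero; in the second, \<open>C\<close> may depend on the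
  accuracy, the truncation and the recovery domain, but not on the mesh.\<close>

theorem theorem4p7:
  fixes A :: "real \<Rightarrow> complex^'n^'n" and T cX cR \<delta> :: real
  assumes "T > 0" and "continuous_on {0..T} A" and "\<delta> > 0"
  shows
    "(\<exists>C>0. \<forall>\<epsilon> X pd R N u0 u w.
        \<epsilon> > 0 \<longrightarrow> X > 0 \<longrightarrow> 1 / X \<le> cX * \<epsilon> \<longrightarrow>
        pd \<ge> lam_max_plus (H1 A) T * T \<longrightarrow> R \<ge> 1 \<longrightarrow> exp R \<le> cR \<longrightarrow>
        \<delta> \<le> pd\<^sup>2 + (spectral_norm (integral {0..T} (H1 A)))\<^sup>2 \<longrightarrow>
        N > 0 \<longrightarrow> solves_linear_ode A T u0 u \<longrightarrow> solves_semidiscrete A T X N u0 w \<longrightarrow>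
        L2_norm_on {pd<..<pd + R} (\<lambda>p. u_hc X N w T p - u T)
          \<le> C * (\<epsilon> + 1 / \<epsilon> * (mesh X N)\<^sup>2 *
                  (pd\<^sup>2 + (spectral_norm (integral {0..T} (H1 A)))\<^sup>2)) * exp pd * norm u0)
     \<and>
     (\<forall>\<epsilon> X pd R.
        \<epsilon> > 0 \<longrightarrow> X > 0 \<longrightarrow> 1 / X \<le> cX * \<epsilon> \<longrightarrow>
        pd \<ge> lam_max_plus (H1 A) T * T \<longrightarrow> R \<ge> 1 \<longrightarrow> exp R \<le> cR \<longrightarrow>
        (\<exists>C>0. \<forall>N u0 u w.
          N > 0 \<longrightarrow> solves_linear_ode A T u0 u \<longrightarrow> solves_semidiscrete A T X N u0 w \<longrightarrow>
          L2_norm_on {pd<..<pd + R} (\<lambda>p. u_hc X N w T p - u T)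
            \<le> C * (\<epsilon> + 1 / \<epsilon> * (mesh X N)\<^sup>2 *
                    (pd\<^sup>2 + (spectral_norm (integral {0..T} (H1 A)))\<^sup>2)) * exp pd * norm u0))"
proof -
  define D where "D = (spectral_norm (integral {0..T} (H1 A)))\<^sup>2"
  have D: "D \<ge> 0" by (simp add: D_def)
  obtain K where K: "K > 0"
    and bound: "\<And>X pd (R :: real) N u0 u w. X > 0 \<Longrightarrow> pd \<ge> lam_max_plus (H1 A) T * T \<Longrightarrow> R \<ge> 1 \<Longrightarrow> N > 0 \<Longrightarrow>
       solves_linear_ode A T u0 u \<Longrightarrow> solves_semidiscrete A T X N u0 w \<Longrightarrow>
       pd \<ge> 0 \<and> L2_norm_on {pd<..<pd + R} (\<lambda>p. u_hc X N w T p - u T)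
         \<le> K * (R * exp R) * (mesh X N * (1 + pd + R) + 1 / X) * exp pd * norm u0"
    using recovery_error_bound[OF assms(1,2)] by blast
  show ?thesis unfolding D_def[symmetric]
  proof (intro conjI allI impI)
    define \<kappa> where "\<kappa> = sqrt (2 * (1 + cR)\<^sup>2 / \<delta> + 2)"
    \<comment> \<open>Here \<open>R \<le> exp R \<le> cR\<close> bounds \<open>R * exp R\<close> by
      \<open>cR * cR\<close>, \<open>\<kappa>\<close> pays for the quadrature and
      \<open>\<bar>cX\<bar>\<close> for the truncation. Passing to \<open>C + 1\<close> below
      ensures positivity.\<close>
    define C where "C = K * (cR * cR) * (\<kappa> + \<bar>cX\<bar>)"
    have \<kappa>: "\<kappa> \<ge> 0" using assms(3) by (simp add: \<kappa>_def add_nonneg_nonneg)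
    have "C \<ge> 0" using K \<kappa> by (simp add: C_def)
    have "L2_norm_on {pd<..<pd + R} (\<lambda>p. u_hc X N w T p - u T)
        \<le> (C + 1) * (\<epsilon> + 1 / \<epsilon> * (mesh X N)\<^sup>2 * (pd\<^sup>2 + D)) * exp pd * norm u0"
      if \<epsilon>: "\<epsilon> > 0" and X: "X > 0" "1 / X \<le> cX * \<epsilon>" and pd: "pd \<ge> lam_max_plus (H1 A) T * T"
        and R: "R \<ge> 1" "exp R \<le> cR" and \<delta>: "\<delta> \<le> pd\<^sup>2 + D" and N: "N > 0"
        and u: "solves_linear_ode A T u0 u" and w: "solves_semidiscrete A T X N u0 w"
      for \<epsilon> X pd R N u0 u w
    proof -
      define E where "E = \<epsilon> + 1 / \<epsilon> * (mesh X N)\<^sup>2 * (pd\<^sup>2 + D)"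
      have E: "\<epsilon> \<le> E" using \<epsilon> D by (simp add: E_def)
      have pd0: "pd \<ge> 0" and L2: "L2_norm_on {pd<..<pd + R} (\<lambda>p. u_hc X N w T p - u T)
         \<le> K * (R * exp R) * (mesh X N * (1 + pd + R) + 1 / X) * exp pd * norm u0"
        using bound[OF X(1) pd R(1) N u w] by auto
      have m: "mesh X N \<ge> 0" using X by (simp add: mesh_def)
      have RcR: "R \<le> cR" using exp_ge_add_one_self[of R] R by linarith
      have "R * exp R \<le> cR * cR" using RcR R by (intro mult_mono) auto
      moreover have "mesh X N * (1 + pd + R) \<le> \<kappa> * E"
        unfolding \<kappa>_def E_def
        by (rule first_order_le_second_order) (use \<epsilon> assms(3) \<delta> m R RcR pd0 D in auto)
      moreover have "1 / X \<le> \<bar>cX\<bar> * E"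
        by (rule order_trans[OF X(2)] mult_mono)+ (use \<epsilon> E in auto)
      ultimately have le: "K * (R * exp R) \<le> K * (cR * cR)" "mesh X N * (1 + pd + R) + 1 / X \<le> (\<kappa> + \<bar>cX\<bar>) * E"
        using K by (auto simp: distrib_right)
      have "K * (R * exp R) * (mesh X N * (1 + pd + R) + 1 / X) \<le> K * (cR * cR) * ((\<kappa> + \<bar>cX\<bar>) * E)"
        by (rule mult_mono[OF le]) (use K R m pd0 X in auto)
      also have "\<dots> \<le> (C + 1) * E" using \<epsilon> E by (simp add: C_def algebra_simps)
      finally have "K * (R * exp R) * (mesh X N * (1 + pd + R) + 1 / X) * exp pd * norm u0 \<le> (C + 1) * E * exp pd * norm u0"
        by (intro mult_right_mono) auto
      with L2 show ?thesis unfolding E_def by (rule order_trans)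
    qed
    with \<open>C \<ge> 0\<close> show "\<exists>C>0. \<forall>\<epsilon> X pd R N u0 u w.
        \<epsilon> > 0 \<longrightarrow> X > 0 \<longrightarrow> 1 / X \<le> cX * \<epsilon> \<longrightarrow>
        pd \<ge> lam_max_plus (H1 A) T * T \<longrightarrow> R \<ge> 1 \<longrightarrow> exp R \<le> cR \<longrightarrow>
        \<delta> \<le> pd\<^sup>2 + D \<longrightarrow>
        N > 0 \<longrightarrow> solves_linear_ode A T u0 u \<longrightarrow> solves_semidiscrete A T X N u0 w \<longrightarrow>
        L2_norm_on {pd<..<pd + R} (\<lambda>p. u_hc X N w T p - u T)
          \<le> C * (\<epsilon> + 1 / \<epsilon> * (mesh X N)\<^sup>2 * (pd\<^sup>2 + D)) * exp pd * norm u0"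
      by (intro exI[of _ "C + 1"]) auto
  next
    fix \<epsilon> X pd R :: real
    assume \<epsilon>: "\<epsilon> > 0" and X: "X > 0" and pd: "pd \<ge> lam_max_plus (H1 A) T * T" and R: "R \<ge> 1"
    \<comment> \<open>With the other parameters fixed, \<open>mesh X N \<le> 2 * X\<close> bounds
      the whole error, so the term \<open>\<epsilon>\<close> alone dominates after division by it.
      The absolute value secures \<open>C > 0\<close> before \<open>pd \<ge> 0\<close> is available,
      which \<open>bound\<close> supplies only for given solutions.\<close>
    define C where "C = K * (R * exp R) * (2 * X * (1 + \<bar>pd\<bar> + R) + 1 / X) / \<epsilon>"
    have C: "C > 0"
      unfolding C_def using K R X \<epsilon> by (intro divide_pos_pos mult_pos_pos add_nonneg_pos) auto
    have "L2_norm_on {pd<..<pd + R} (\<lambda>p. u_hc X N w T p - u T)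
            \<le> C * (\<epsilon> + 1 / \<epsilon> * (mesh X N)\<^sup>2 * (pd\<^sup>2 + D)) * exp pd * norm u0"
      if N: "N > 0" and u: "solves_linear_ode A T u0 u" and w: "solves_semidiscrete A T X N u0 w" for N u0 u w
    proof -
      have pd0: "pd \<ge> 0" and L2: "L2_norm_on {pd<..<pd + R} (\<lambda>p. u_hc X N w T p - u T)
         \<le> K * (R * exp R) * (mesh X N * (1 + pd + R) + 1 / X) * exp pd * norm u0"
        using bound[OF X pd R N u w] by auto
      have "2 * X / real N \<le> 2 * X / 1" using N X by (intro divide_left_mono) auto
      then have "mesh X N \<le> 2 * X" by (simp add: mesh_def)
      then have "K * (R * exp R) * (mesh X N * (1 + pd + R) + 1 / X) \<le> K * (R * exp R) * (2 * X * (1 + \<bar>pd\<bar> + R) + 1 / X)"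
        using K R pd0 X by (intro mult_left_mono add_right_mono mult_mono) auto
      also have "\<dots> = C * \<epsilon>" using \<epsilon> by (simp add: C_def)
      also have "\<dots> \<le> C * (\<epsilon> + 1 / \<epsilon> * (mesh X N)\<^sup>2 * (pd\<^sup>2 + D))"
        using C \<epsilon> D by (intro mult_left_mono) auto
      finally have "K * (R * exp R) * (mesh X N * (1 + pd + R) + 1 / X) * exp pd * norm u0
          \<le> C * (\<epsilon> + 1 / \<epsilon> * (mesh X N)\<^sup>2 * (pd\<^sup>2 + D)) * exp pd * norm u0"
        by (intro mult_right_mono) auto
      with L2 show ?thesis by linarith
    qed
    with C show "\<exists>C>0. \<forall>N u0 u w.
          N > 0 \<longrightarrow> solves_linear_ode A T u0 u \<longrightarrow> solves_semidiscrete A T X N u0 w \<longrightarrow>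
          L2_norm_on {pd<..<pd + R} (\<lambda>p. u_hc X N w T p - u T)
            \<le> C * (\<epsilon> + 1 / \<epsilon> * (mesh X N)\<^sup>2 * (pd\<^sup>2 + D)) * exp pd * norm u0"
      by blast
  qed
qed

end
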